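(* Let $\psi:[0,1]\to\mathbb{R}_+$ be twice continuously differentiable with non-vanishing curvature, i.e. $\psi''(x)\neq 0$ for all $x\in[0,1]$. Let $L<\infty$ be a constant with $\psi(x)\le L$ for all $x\in[0,1]$. For $k\ge 3$ let $$\mathcal{F}_k=\Big\{\Big(\frac{j}{F_k},\Big\{\frac{jF_{k-1}}{F_k}\Big\}\Big) \mid j=1,\ldots,F_k\Big\}.$$ Then there is a constant $C'_{\psi,L}$ depending only on $\psi$ and $L$ such that for every $k$ for which the number $N$ of accepted points is at least $1$, $$D^*_{N,\psi}\big(Q_N(\mathcal{F}_k;\psi)\big)\le C'_{\psi,L}\,N^{-2/3}.$$
   Context: $F_k$ is the $k$-th Fibonacci number: $F_1=F_2=1$, $F_k=F_{k-1}+F_{k-2}$ for $k\ge3$. For $x\ge 0$, $\{x\}=x-\lfloor x\rfloor$. Deterministic acceptance-rejection sampler: given $\psi:[0,1]\to\mathbb{R}_+$ with $\psi\le L$ on $[0,1]$, let $A=\{(x_1,x_2)\in[0,1]^2 \mid \psi(x_1)\ge Lx_2\}$. Given a driver point set $T_M=\{\boldsymbol{x}_1,\ldots,\boldsymbol{x}_M\}\subset[0,1]^2$, accept those $\boldsymbol{x}_j$ lying in $A$; let $N=\#\{j: \boldsymbol{x}_j\in A\}$ and let $Q_N(T_M;\psi)=\{y_1,\ldots,y_N\}\subset[0,1]$ be the first coordinates of the accepted points. For $P_N=\{p_1,\ldots,p_N\}\subset[0,1]$, $$D^*_{N,\psi}(P_N)=\sup_{t\in[0,1]}\Big|\frac1N\sum_{j=1}^N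 1_{[0,t)}(p_j)-\frac1C\int_0^t\psi(z)\,dz\Big|,\qquad C=\int_0^1\psi(z)\,dz>0.$$ *)

theory Defs
  imports "HOL-Analysis.Analysis" "HOL-Number_Theory.Fib"
begin

definition C2_nonvanishing_curv :: "(real \<Rightarrow> real) \<Rightarrow> bool" where
  "C2_nonvanishing_curv \<psi> \<longleftrightarrow>
     (\<exists>\<psi>' \<psi>''. (\<forall>x\<in>{0..1}. (\<psi> has_real_derivative \<psi>' x) (at x within {0..1})
                          \<and> (\<psi>' has_real_derivative \<psi>'' x) (at x within {0..1}))
              \<and> continuous_on {0..1} \<psi>''
              \<and> (\<forall>x\<in>{0..1}. \<psi>'' x \<noteq> 0))"

definition disc_star :: "(real \<Rightarrow> real) \<Rightarrow> real list \<Rightarrow> real" where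
  "disc_star \<psi> P = (SUP t\<in>{0..1::real}.
      \<bar>real (length (filter (\<lambda>p. p < t) P)) / real (length P)
        - integral {0..t} \<psi> / integral {0..1} \<psi>\<bar>)"

definition fib_lattice :: "nat \<Rightarrow> (real \<times> real) list" where
  "fib_lattice k = map (\<lambda>j. (real j / real (fib k), frac (real j * real (fib (k - 1)) / real (fib k))))
                      [1..<fib k + 1]"

definition accept_reject :: "(real \<Rightarrow> real) \<Rightarrow> real \<Rightarrow> (real \<times> real) list \<Rightarrow> real list" where
  "accept_reject \<psi> L T = map fst (filter (\<lambda>(x1, x2). \<psi> x1 \<ge> L * x2) T)"

end

theory Submission
  imports Defs
begin

text \<open>
  Write \<open>M = fib k\<close>, \<open>\<alpha> = fib (k - 1) / M\<close> and \<open>g = \<psi> / L\<close>. Up to a Riemann sum, the number of accepted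
  points to the left of \<open>t\<close> differs from its expected value by the sawtooth sums over \<open>j \<alpha>\<close> and over
  \<open>g(j / M) - j \<alpha>\<close>. An inequality of Erdos-Turan type with cut-off about \<open>M\<close> to the power \<open>2/3\<close> bounds
  these by exponential sums with frequencies \<open>h\<close>. If \<open>h \<alpha>\<close> is not too close to an integer, the
  Kuzmin-Landau inequality gives the bound \<open>1 / \<parallel>h \<alpha>\<parallel>\<close>; otherwise the curvature of \<open>g\<close> gives \<open>M / sqrt h\<close>
  by van der Corput's second derivative test. As \<open>\<alpha>\<close> is badly approximable, the numbers \<open>h \<alpha>\<close> modulo 1
  with \<open>h\<close> in a dyadic block are well spaced, so that the second case is rare, and summing over the
  blocks gives an error of order \<open>M\<close> to the power \<open>1/3\<close>.
\<close>

subsection \<open>Integrals of the sawtooth against trigonometric functions\<close>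

text \<open>Used for every frequency, the curvature bound \<open>M / sqrt h\<close> would, after
  weighting by \<open>1 / h\<close>, sum to order \<open>M\<close>, which is trivial. The gain comes
  from how rarely it is needed. With \<open>B\<close> bounding the slope of \<open>g\<close>, it is
  needed only when \<open>h \<alpha>\<close> lies within \<open>2 h B / M\<close> of an integer,
  whereas bad approximability keeps \<open>h \<alpha>\<close> at distance at least
  \<open>1 / (8 h)\<close>. So this happens only for \<open>h\<close> at least of order
  \<open>sqrt M\<close> (constants depending on \<open>B\<close>), and for at most order
  \<open>D^2 B / M\<close> frequencies in the block from \<open>D\<close> to \<open>2 D\<close>.
  Weighted by \<open>1 / h\<close>, each regime then costs order \<open>sqrt D\<close> per block,
  and the blocks below a cut-off \<open>R\<close> add up geometrically to order
  \<open>sqrt R\<close>. Balancing this against the truncation error \<open>M / R\<close> fixes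
  \<open>R\<close> near the power \<open>2/3\<close> of \<open>M\<close>. The passage from powers of
  \<open>M\<close> to powers of \<open>N\<close> uses that \<open>M\<close> is at most a constant
  times \<open>N\<close>.\<close>

definition saw :: "real \<Rightarrow> real" where "saw x = frac x - 1/2"

lemma saw_add_le: "0 \<le> w \<Longrightarrow> saw (x + w) \<le> saw x + w"
  unfolding saw_def frac_def by (simp add: floor_mono)

lemma abs_saw_le: "\<bar>saw x\<bar> \<le> 1/2"
  using frac_ge_0[of x] frac_lt_1[of x] unfolding saw_def by linarith

text \<open>The argument \<open>z + v\<close> reaches the integer \<open>m\<close> at
  \<open>v = b\<close>. On each side of \<open>b\<close> the map \<open>frac\<close> is a
  translation, and the two translated pieces tile \<open>{0..1}\<close>. One end point of each piece
  is discarded, so \<open>f\<close> may differ at 0 and 1.\<close>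

lemma has_integral_frac_shift:
  fixes f :: "real \<Rightarrow> real"
  assumes f: "continuous_on {0..1} f"
  shows "((\<lambda>v. f (frac (z + v))) has_integral integral {0..1} f) {-1/2..1/2}"
proof -
  define m where "m = \<lfloor>z + 1/2\<rfloor>"
  define b where "b = of_int m - z"
  have b: "-1/2 \<le> b" "b \<le> 1/2" unfolding b_def m_def by linarith+
  have int: "(f has_integral integral {u..w} f) {u..w}" if "0 \<le> u" "w \<le> 1" for u w
    using that by (intro integrable_integral integrable_continuous_real continuous_on_subset[OF f]) auto
  have "((\<lambda>v. f (v + (1 - b))) has_integral integral {1/2 - b..1} f) {-1/2..b}"
    using has_integral_shift_Icc_real[of f "1 - b" _ "-1/2" b] int[of "1/2 - b" 1] b
    by (simp add: o_def add.commute)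
  then have 1: "((\<lambda>v. f (frac (z + v))) has_integral integral {1/2 - b..1} f) {-1/2..b}"
  proof (rule has_integral_spike_finite[rotated 2])
    show "f (frac (z + v)) = f (v + (1 - b))" if "v \<in> {-1/2..b} - {b}" for v
    proof -
      have "frac (z + v) = v + (1 - b)"
        unfolding frac_unique_iff using that b by (auto simp: b_def)
      then show ?thesis by simp
    qed
  qed auto
  have "((\<lambda>v. f (v + (- b))) has_integral integral {0..1/2-b} f) {b..1/2}"
    using has_integral_shift_Icc_real[of f "- b" _ b "1/2"] int[of 0 "1/2 - b"] b
    by (simp add: o_def add.commute)
  then have 2: "((\<lambda>v. f (frac (z + v))) has_integral integral {0..1/2-b} f) {b..1/2}"
  proof (rule has_integral_spike_finite[rotated 2])
    show "f (frac (z + v)) = f (v + (- b))" if "v \<in> {b..1/2} - {1/2}" for v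
    proof -
      have "frac (z + v) = v + (- b)"
        unfolding frac_unique_iff using that b by (auto simp: b_def)
      then show ?thesis by simp
    qed
  qed auto
  have "integral {0..1/2-b} f + integral {1/2-b..1} f = integral {0..1} f"
    using b by (intro Henstock_Kurzweil_Integration.integral_combine integrable_continuous_real f) auto
  with has_integral_combine[OF b 1 2] show ?thesis by (simp add: add.commute)
qed

lemma has_integral_cos_int:
  fixes a :: int
  shows "((\<lambda>v. cos (2 * pi * of_int a * v)) has_integral of_bool (a = 0)) {-1/2..1/2::real}"
proof (cases "a = 0")
  case True
  then show ?thesis using has_integral_const_real[of "1::real" "-1/2" "1/2"] by simp
next
  case False
  have "((\<lambda>v. cos (2 * pi * of_int a * v)) has_integral
     (sin (2 * pi * of_int a * (1/2)) / (2 * pi * of_int a) - sin (2 * pi * of_int a * (-1/2)) / (2 * pi * of_int a))) {-1/2..1/2::real}"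
    using False by (intro fundamental_theorem_of_calculus)
      (auto intro!: derivative_eq_intros simp flip: has_real_derivative_iff_has_vector_derivative)
  then show ?thesis using False by (simp add: sin_zero_iff_int2 field_simps)
qed

text \<open>The Fourier coefficients of the sawtooth, with the phase of the shift \<open>z\<close>.
  The antiderivative \<open>F\<close> comes from integration by parts; the cosine ignores the floor
  in \<open>frac\<close> because its frequency is an integer.\<close>

lemma has_integral_saw_cos:
  fixes a :: int
  assumes "a \<noteq> 0"
  shows "((\<lambda>v. saw (z + v) * cos (2 * pi * of_int a * v)) has_integral
            - (sin (2 * pi * of_int a * z) / (2 * pi * of_int a))) {-1/2..1/2}"
proof -
  define w where "w = 2 * pi * real_of_int a"
  have w: "w \<noteq> 0" using assms by (simp add: w_def)
  define f where "f y = (y - 1/2) * cos (w * (y - z))" for y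
  define F where "F y = (y - 1/2) * sin (w * (y - z)) / w + cos (w * (y - z)) / w\<^sup>2" for y
  have "(f has_integral F 1 - F 0) {0..1}"
    unfolding f_def F_def using w
    by (intro fundamental_theorem_of_calculus)
      (auto intro!: derivative_eq_intros simp: field_simps power2_eq_square
        simp flip: has_real_derivative_iff_has_vector_derivative)
  moreover have "sin (w * (1 - z)) = sin (w * (0 - z))" "cos (w * (1 - z)) = cos (w * (0 - z))"
    by (simp_all add: w_def right_diff_distrib sin_diff cos_diff)
  then have "F 1 - F 0 = - (sin (w * z) / w)"
    by (simp add: F_def field_simps)
  ultimately have "integral {0..1} f = - (sin (w * z) / w)" by (simp add: integral_unique)
  moreover have "f (frac (z + v)) = saw (z + v) * cos (w * v)" for v
  proof -
    have "cos (w * (frac (z + v) - z)) = cos (w * v - 2 * pi * of_int (a * \<lfloor>z + v\<rfloor>))"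
      by (simp add: frac_def w_def algebra_simps)
    also have "\<dots> = cos (w * v)"
      using sin_int_2pin[of "a * \<lfloor>z + v\<rfloor>"] cos_int_2pin[of "a * \<lfloor>z + v\<rfloor>"] by (simp add: cos_diff)
    finally show ?thesis by (simp add: f_def saw_def)
  qed
  moreover have "continuous_on {0..1} f" unfolding f_def by (intro continuous_intros)
  ultimately show ?thesis using has_integral_frac_shift[of f z] by (simp add: w_def)
qed

lemma has_integral_saw: "((\<lambda>v. saw (z + v)) has_integral 0) {-1/2..1/2}"
proof -
  have "((\<lambda>y. y - 1/2) has_integral ((1::real)\<^sup>2/2 - 1/2) - (0\<^sup>2/2 - 0/2)) {0..1}"
    by (intro fundamental_theorem_of_calculus)
      (auto intro!: derivative_eq_intros simp flip: has_real_derivative_iff_has_vector_derivative)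
  then have "integral {0..1} (\<lambda>y. y - 1/2 :: real) = 0" by (simp add: integral_unique)
  then show ?thesis
    using has_integral_frac_shift[of "\<lambda>y. y - 1/2" z] by (simp add: saw_def continuous_intros)
qed

subsection \<open>A nonnegative trigonometric kernel\<close>

text \<open>The kernel is the square of the modulus of the trigonometric polynomial with coefficients
  \<open>r (R - r)\<close>. It is nonnegative, and because the coefficients vanish smoothly at both ends its second
  moment is of order \<open>1 / R\<^sup>2\<close>, which the Fejer kernel does not achieve.\<close>

definition ker_coeff :: "nat \<Rightarrow> nat \<Rightarrow> real" where
  "ker_coeff R r = real r * (real R - real r)"

definition ker_mass :: "nat \<Rightarrow> real" where
  "ker_mass R = (\<Sum>r<R. (ker_coeff R r)\<^sup>2)"

definition ker :: "nat \<Rightarrow> real \<Rightarrow> real" where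
  "ker R v = (\<Sum>r<R. \<Sum>r'<R. ker_coeff R r * ker_coeff R r' * cos (2 * pi * of_int (int r - int r') * v))"

lemma ker_nonneg: "0 \<le> ker R v"
proof -
  have "ker R v = (\<Sum>r<R. ker_coeff R r * cos (2 * pi * r * v))\<^sup>2
                + (\<Sum>r<R. ker_coeff R r * sin (2 * pi * r * v))\<^sup>2"
    unfolding power2_eq_square sum_product ker_def sum.distrib[symmetric]
    by (intro sum.cong refl) (simp add: left_diff_distrib right_diff_distrib cos_diff algebra_simps)
  then show ?thesis by simp
qed

text \<open>Both the summand and the range depend on \<open>R\<close>. Separating them into
  \<open>x\<close> and \<open>n\<close> gives a polynomial identity that can be proved by induction
  on \<open>n\<close>.\<close>

lemma ker_mass_eq: "ker_mass R = real R * (real R ^ 4 - 1) / 30"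
proof -
  have "(\<Sum>r<n. (real r * (x - real r))\<^sup>2) =
      x\<^sup>2 * ((real n - 1) * n * (2 * n - 1)) / 6 - x * (n * (real n - 1))\<^sup>2 / 2
      + (real n - 1) * n * (2 * n - 1) * (3 * (real n)\<^sup>2 - 3 * n - 1) / 30" for n and x :: real
    by (induction n) (simp_all add: field_simps power2_eq_square)
  from this[of "real R" R] show ?thesis
    unfolding ker_mass_def ker_coeff_def
    by (simp add: field_simps power2_eq_square power4_eq_xxxx)
qed

text \<open>Since the coefficients vanish at \<open>0\<close> and \<open>R\<close>, the left side is
  half the sum of their squared consecutive differences. It has order \<open>R^3\<close> against a
  mass of order \<open>R^5\<close>, which is the source of the second moment of relative size
  \<open>1 / R^2\<close>.\<close>

lemma ker_corr_eq:
  "ker_mass R - (\<Sum>r<R. ker_coeff R r * ker_coeff R (Suc r)) = real R * ((real R)\<^sup>2 - 1) / 6"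
proof -
  have "(\<Sum>r<n. real r * (x - real r) * (2 * real r + 1 - x)) =
     - (n * (real n - 1))\<^sup>2 / 2 + (3 * x - 1) * ((real n - 1) * n * (2 * n - 1)) / 6
     + (x - x\<^sup>2) * (n * (real n - 1)) / 2" for n and x :: real
    by (induction n) (simp_all add: field_simps power2_eq_square)
  note * = this[of "real R" R]
  have "ker_mass R - (\<Sum>r<R. ker_coeff R r * ker_coeff R (Suc r)) =
     (\<Sum>r<R. real r * (real R - real r) * (2 * real r + 1 - real R))"
    unfolding ker_mass_def sum_subtractf[symmetric]
    by (intro sum.cong) (auto simp: ker_coeff_def algebra_simps power2_eq_square)
  then show ?thesis
    unfolding * by (simp add: field_simps power2_eq_square)
qed

lemma has_integral_ker: "(ker R has_integral ker_mass R) {-1/2..1/2}"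
proof -
  have "((\<lambda>v. ker R v) has_integral (\<Sum>r<R. \<Sum>r'<R. ker_coeff R r * ker_coeff R r' * of_bool (int r - int r' = 0))) {-1/2..1/2}"
    unfolding ker_def by (intro has_integral_sum has_integral_mult_right has_integral_cos_int finite_lessThan)
  also have "(\<Sum>r<R. \<Sum>r'<R. ker_coeff R r * ker_coeff R r' * of_bool (int r - int r' = 0)) = ker_mass R"
    unfolding ker_mass_def
    by (intro sum.cong refl) (simp add: of_bool_def if_distrib[of "(*) _"] power2_eq_square cong: if_cong)
  finally show ?thesis by simp
qed

text \<open>The second moment is measured by the squared sine instead of \<open>v^2\<close> because
  this is itself a trigonometric polynomial: multiplying by it shifts frequencies by one, so that
  orthogonality picks out products of neighbouring coefficients.\<close>

lemma has_integral_ker_sin2: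
  "((\<lambda>v. ker R v * (sin (pi * v))\<^sup>2) has_integral real R * ((real R)\<^sup>2 - 1) / 12) {-1/2..1/2}"
proof -
  let ?e = "\<lambda>a b. of_bool (a = b) :: real"
  define A where "A = (\<lambda>r r'. ker_coeff R r * ker_coeff R r')"
  have 1: "((\<lambda>v. \<Sum>r<R. \<Sum>r'<R. A r r' * (cos (2 * pi * of_int (int r - int r' + 1) * v) + cos (2 * pi * of_int (int r - int r' - 1) * v)))
     has_integral (\<Sum>r<R. \<Sum>r'<R. A r r' * (of_bool (int r - int r' + 1 = 0) + of_bool (int r - int r' - 1 = 0)))) {-1/2..1/2}"
    by (intro has_integral_sum has_integral_mult_right has_integral_add has_integral_cos_int finite_lessThan)
  have 2: "(\<Sum>r<R. \<Sum>r'<R. A r r' * of_bool (int r - int r' + 1 = 0)) = (\<Sum>r<R. A r (Suc r))"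
  proof (intro sum.cong refl)
    fix r assume "r \<in> {..<R}"
    have "int r - int r' + 1 = 0 \<longleftrightarrow> r' = Suc r" for r' by auto
    then have "(\<Sum>r'<R. A r r' * of_bool (int r - int r' + 1 = 0)) = (if Suc r < R then A r (Suc r) else 0)"
      by (simp add: of_bool_def if_distrib[of "(*) _"] cong: if_cong)
    \<comment> \<open>The index \<open>Suc r = R\<close> lies outside the range, but
      \<open>ker_coeff R R = 0\<close>, so the case distinction disappears.\<close>
    also have "\<dots> = A r (Suc r)"
    proof (cases "Suc r < R")
      case False
      with \<open>r \<in> _\<close> have "R = Suc r" by auto
      then show ?thesis by (simp add: A_def ker_coeff_def)
    qed simp
    finally show "(\<Sum>r'<R. A r r' * of_bool (int r - int r' + 1 = 0)) = A r (Suc r)" .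
  qed
  have 3: "(\<Sum>r<R. \<Sum>r'<R. A r r' * of_bool (int r - int r' - 1 = 0)) = (\<Sum>r<R. A r (Suc r))"
  proof -
    have "int r - int r' - 1 = 0 \<longleftrightarrow> int r' - int r + 1 = 0" for r r' by auto
    then show ?thesis
      by (subst sum.swap) (simp add: A_def mult.commute flip: 2[unfolded A_def])
  qed
  have "(\<Sum>r<R. \<Sum>r'<R. A r r' * (of_bool (int r - int r' + 1 = 0) + of_bool (int r - int r' - 1 = 0))) = 2 * (\<Sum>r<R. A r (Suc r))"
    by (simp only: distrib_left sum.distrib 2 3 mult_2)
  note 4 = 1[unfolded this]
  have "((\<lambda>v. 1/2 * ker R v - 1/4 * (\<Sum>r<R. \<Sum>r'<R. A r r' * (cos (2 * pi * of_int (int r - int r' + 1) * v) + cos (2 * pi * of_int (int r - int r' - 1) * v))))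
     has_integral 1/2 * ker_mass R - 1/4 * (2 * (\<Sum>r<R. A r (Suc r)))) {-1/2..1/2}"
    by (intro has_integral_diff has_integral_mult_right has_integral_ker 4)
  also have "1/2 * ker_mass R - 1/4 * (2 * (\<Sum>r<R. A r (Suc r))) = real R * ((real R)\<^sup>2 - 1) / 12"
    using ker_corr_eq[of R] by (simp add: A_def)
  also have "(\<lambda>v. 1/2 * ker R v - 1/4 * (\<Sum>r<R. \<Sum>r'<R. A r r' * (cos (2 * pi * of_int (int r - int r' + 1) * v) + cos (2 * pi * of_int (int r - int r' - 1) * v))))
     = (\<lambda>v. ker R v * (sin (pi * v))\<^sup>2)"
  proof
    fix v
    have 5: "cos (2 * pi * of_int (a + 1) * v) + cos (2 * pi * of_int (a - 1) * v) = 2 * cos (2 * pi * of_int a * v) * cos (2 * pi * v)" for a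
      by (simp add: algebra_simps cos_add cos_diff)
    have alg: "1/2 * (p * C) - 1/4 * (p * (2 * C * D)) = p * C * (1/2 - D / 2)" for p C D :: real
      by (simp add: field_simps)
    have 6: "(sin (pi * v))\<^sup>2 = 1/2 - cos (2 * pi * v) / 2"
      using cos_double_sin[of "pi * v"] by (simp add: mult.assoc diff_divide_distrib)
    show "1/2 * ker R v - 1/4 * (\<Sum>r<R. \<Sum>r'<R. A r r' * (cos (2 * pi * of_int (int r - int r' + 1) * v) + cos (2 * pi * of_int (int r - int r' - 1) * v)))
      = ker R v * (sin (pi * v))\<^sup>2"
      unfolding ker_def A_def 5 6 sum_distrib_left sum_distrib_right sum_subtractf[symmetric]
      by (intro sum.cong refl alg)
  qed
  finally show ?thesis .
qed

definition weyl_sum :: "(nat \<Rightarrow> real) \<Rightarrow> nat set \<Rightarrow> nat \<Rightarrow> real" where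
  "weyl_sum x J h = norm (\<Sum>j\<in>J. cis (2 * pi * (real h * x j)))"

text \<open>The shift \<open>c\<close> contributes only a factor of modulus one, so the bound is
  uniform in \<open>c\<close>. This allows the kernel to be centred anywhere.\<close>

lemma abs_sin_sum_le:
  fixes a :: int
  assumes "a \<noteq> 0"
  shows "\<bar>\<Sum>j\<in>J. sin (2 * pi * of_int a * (x j + c)) / (2 * pi * of_int a)\<bar>
     \<le> weyl_sum x J (nat \<bar>a\<bar>) / (2 * pi * real (nat \<bar>a\<bar>))"
proof -
  have *: "\<bar>\<Sum>j\<in>J. sin (2 * pi * real h * (x j + c))\<bar> \<le> weyl_sum x J h" for h
  proof -
    have "(\<Sum>j\<in>J. sin (2 * pi * real h * (x j + c))) = Im (cis (2 * pi * real h * c) * (\<Sum>j\<in>J. cis (2 * pi * (real h * x j))))"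
      by (simp add: sum_distrib_left cis_mult distrib_left mult_ac add_ac del: sin_add flip: cis.sel)
    also have "\<bar>\<dots>\<bar> \<le> norm (cis (2 * pi * real h * c) * (\<Sum>j\<in>J. cis (2 * pi * (real h * x j))))"
      by (rule abs_Im_le_cmod)
    finally show ?thesis by (simp add: norm_mult weyl_sum_def)
  qed
  have "(\<Sum>j\<in>J. sin (2 * pi * of_int a * (x j + c)) / (2 * pi * of_int a))
     = (\<Sum>j\<in>J. sin (2 * pi * real (nat \<bar>a\<bar>) * (x j + c))) / (2 * pi * real (nat \<bar>a\<bar>))"
    unfolding sum_divide_distrib by (intro sum.cong refl) (cases "a \<ge> 0"; simp)
  then show ?thesis using *[of "nat \<bar>a\<bar>"] by (simp add: divide_right_mono)
qed

subsection \<open>The Erdos-Turan inequality for the sawtooth\<close>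

text \<open>Each distance \<open>h\<close> occurs for at most two \<open>r'\<close>, one on either
  side of \<open>r\<close>.\<close>

lemma sum_abs_diff_le:
  fixes V :: "nat \<Rightarrow> real"
  assumes "\<And>h. 0 \<le> V h" "r < R"
  shows "(\<Sum>r'\<in>{..<R} - {r}. V (nat \<bar>int r - int r'\<bar>)) \<le> 2 * (\<Sum>h=1..<R. V h)"
proof -
  have disj: "{..<r} \<inter> {r<..<R} = {}" by auto
  have "{..<R} - {r} = {..<r} \<union> {r<..<R}" using assms(2) by auto
  then have "(\<Sum>r'\<in>{..<R} - {r}. V (nat \<bar>int r - int r'\<bar>)) =
      (\<Sum>r'\<in>{..<r}. V (nat \<bar>int r - int r'\<bar>)) + (\<Sum>r'\<in>{r<..<R}. V (nat \<bar>int r - int r'\<bar>))"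
    by (metis sum.union_disjoint[OF finite_lessThan finite_greaterThanLessThan disj])
  also have "(\<Sum>r'\<in>{..<r}. V (nat \<bar>int r - int r'\<bar>)) = (\<Sum>h\<in>{1..r}. V h)"
    by (rule sum.reindex_bij_witness[of _ "\<lambda>h. r - h" "\<lambda>r'. r - r'"]) (auto simp: nat_diff_distrib' of_nat_diff)
  also have "(\<Sum>r'\<in>{r<..<R}. V (nat \<bar>int r - int r'\<bar>)) = (\<Sum>h\<in>{1..<R - r}. V h)"
    by (rule sum.reindex_bij_witness[of _ "\<lambda>h. r + h" "\<lambda>r'. r' - r"]) (auto simp: nat_diff_distrib' of_nat_diff)
  also have "(\<Sum>h\<in>{1..r}. V h) \<le> (\<Sum>h=1..<R. V h)"
    using assms by (intro sum_mono2) auto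
  also have "(\<Sum>h\<in>{1..<R - r}. V h) \<le> (\<Sum>h=1..<R. V h)"
    using assms by (intro sum_mono2) auto
  finally show ?thesis by simp
qed

text \<open>Averaging against the kernel leaves a quadratic form in the coefficients whose entries
  involve only frequencies below \<open>R\<close>; the diagonal drops out because the sawtooth has
  mean zero. As in Schur's test, AM-GM on \<open>p r * p r'\<close> bounds the form by the mass
  times the largest row sum. For infinite \<open>J\<close> all sums are 0 by convention.\<close>

lemma ker_saw_integral:
  obtains I where
    "((\<lambda>v. ker R v * (\<Sum>j\<in>J. saw (x j + c + v))) has_integral I) {-1/2..1/2}"
    "\<bar>I\<bar> \<le> ker_mass R * (\<Sum>h=1..<R. weyl_sum x J h / (pi * real h))"
proof (cases "finite J")
  case False
  then show ?thesis
    by (intro that[of 0]) (auto simp: ker_mass_def intro!: mult_nonneg_nonneg sum_nonneg divide_nonneg_nonneg simp: weyl_sum_def)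
next
  case J: True
  define p where "p = ker_coeff R"
  define V where "V h = weyl_sum x J h / (2 * pi * real h)" for h
  define W where "W a = (if a = 0 then 0 else - (\<Sum>j\<in>J. sin (2 * pi * of_int a * (x j + c)) / (2 * pi * of_int a)))" for a :: int
  have V: "0 \<le> V h" for h by (simp add: V_def weyl_sum_def)
  have W: "\<bar>W a\<bar> \<le> V (nat \<bar>a\<bar>)" for a
    using abs_sin_sum_le[of a] V by (simp add: W_def V_def)
  have int: "((\<lambda>v. \<Sum>j\<in>J. saw (x j + c + v) * cos (2 * pi * of_int a * v)) has_integral W a) {-1/2..1/2}" for a
  proof (cases "a = 0")
    case True
    then show ?thesis
      using has_integral_sum[OF J, of "\<lambda>j v. saw (x j + c + v)" "\<lambda>_. 0" "{-1/2..1/2}"] has_integral_saw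
      by (simp add: W_def)
  next
    case False
    then show ?thesis
      unfolding W_def if_not_P[OF False] sum_negf[symmetric]
      by (intro has_integral_sum has_integral_saw_cos J)
  qed
  define I where "I = (\<Sum>r<R. \<Sum>r'<R. p r * p r' * W (int r - int r'))"
  have "((\<lambda>v. \<Sum>r<R. \<Sum>r'<R. p r * p r' * (\<Sum>j\<in>J. saw (x j + c + v) * cos (2 * pi * of_int (int r - int r') * v))) has_integral I) {-1/2..1/2}"
    unfolding I_def by (intro has_integral_sum has_integral_mult_right int finite_lessThan)
  also have "(\<lambda>v. \<Sum>r<R. \<Sum>r'<R. p r * p r' * (\<Sum>j\<in>J. saw (x j + c + v) * cos (2 * pi * of_int (int r - int r') * v)))
     = (\<lambda>v. ker R v * (\<Sum>j\<in>J. saw (x j + c + v)))"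
  proof
    fix v
    have "(\<Sum>j\<in>J. saw (x j + c + v) * cos (2 * pi * of_int a * v)) = cos (2 * pi * of_int a * v) * (\<Sum>j\<in>J. saw (x j + c + v))" for a
      unfolding sum_distrib_right[symmetric] by (rule mult.commute)
    then show "(\<Sum>r<R. \<Sum>r'<R. p r * p r' * (\<Sum>j\<in>J. saw (x j + c + v) * cos (2 * pi * of_int (int r - int r') * v)))
      = ker R v * (\<Sum>j\<in>J. saw (x j + c + v))"
      by (simp only: ker_def p_def sum_distrib_right mult.assoc)
  qed
  finally have 1: "((\<lambda>v. ker R v * (\<Sum>j\<in>J. saw (x j + c + v))) has_integral I) {-1/2..1/2}" .
  define U where "U r r' = (if r = r' then 0 else V (nat \<bar>int r - int r'\<bar>))" for r r'
  have U: "0 \<le> U r r'" "U r r' = U r' r" for r r' using V by (auto simp: U_def abs_minus_commute)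
  have U_sum: "(\<Sum>r'<R. U r r') \<le> 2 * (\<Sum>h=1..<R. V h)" if "r < R" for r
  proof -
    have "(\<Sum>r'<R. U r r') = (\<Sum>r'\<in>{..<R} - {r}. V (nat \<bar>int r - int r'\<bar>))"
      by (rule sum.mono_neutral_cong_right) (auto simp: U_def)
    then show ?thesis using sum_abs_diff_le[OF V that] by simp
  qed
  have "\<bar>I\<bar> \<le> (\<Sum>r<R. \<Sum>r'<R. \<bar>p r * p r' * W (int r - int r')\<bar>)"
    unfolding I_def by (intro order_trans[OF sum_abs] sum_mono sum_abs)
  also have "\<dots> \<le> (\<Sum>r<R. \<Sum>r'<R. ((p r)\<^sup>2 + (p r')\<^sup>2) / 2 * U r r')"
  proof (intro sum_mono)
    fix r r' assume r: "r \<in> {..<R}" "r' \<in> {..<R}"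
    have "\<bar>W (int r - int r')\<bar> \<le> U r r'"
      using W[of "int r - int r'"] by (auto simp: U_def W_def)
    moreover have "\<bar>p r * p r'\<bar> \<le> ((p r)\<^sup>2 + (p r')\<^sup>2) / 2"
      using sum_squares_bound[of "\<bar>p r\<bar>" "\<bar>p r'\<bar>"] by (simp add: abs_mult)
    ultimately show "\<bar>p r * p r' * W (int r - int r')\<bar> \<le> ((p r)\<^sup>2 + (p r')\<^sup>2) / 2 * U r r'"
      unfolding abs_mult[of "p r * p r'"] by (intro mult_mono) auto
  qed
  also have "\<dots> = (\<Sum>r<R. \<Sum>r'<R. (p r)\<^sup>2 / 2 * U r r') + (\<Sum>r<R. \<Sum>r'<R. (p r')\<^sup>2 / 2 * U r r')"
    by (simp add: add_divide_distrib distrib_right sum.distrib)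
  also have "(\<Sum>r<R. \<Sum>r'<R. (p r')\<^sup>2 / 2 * U r r') = (\<Sum>r<R. \<Sum>r'<R. (p r)\<^sup>2 / 2 * U r r')"
    by (subst sum.swap) (simp add: U(2))
  also have "(\<Sum>r<R. \<Sum>r'<R. (p r)\<^sup>2 / 2 * U r r') + (\<Sum>r<R. \<Sum>r'<R. (p r)\<^sup>2 / 2 * U r r') = (\<Sum>r<R. (p r)\<^sup>2 * (\<Sum>r'<R. U r r'))"
    unfolding sum.distrib[symmetric] sum_distrib_left by (intro sum.cong refl) (simp add: field_simps)
  also have "\<dots> \<le> (\<Sum>r<R. (p r)\<^sup>2 * (2 * (\<Sum>h=1..<R. V h)))"
    by (intro sum_mono mult_left_mono U_sum) auto
  also have "\<dots> = ker_mass R * (2 * (\<Sum>h=1..<R. V h))"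
    by (simp add: ker_mass_def p_def sum_distrib_right)
  also have "2 * (\<Sum>h=1..<R. V h) = (\<Sum>h=1..<R. weyl_sum x J h / (pi * real h))"
    by (simp add: V_def sum_distrib_left)
  finally show ?thesis using 1 that by blast
qed

text \<open>A weak form of Jordan's inequality. Beyond \<open>1/6\<close> the sine is already at
  least \<open>1/2\<close>; below it, the cosine in the mean value theorem is at least
  \<open>1/2\<close>.\<close>

lemma sin_pi_ge:
  assumes "0 \<le> x" "x \<le> 1/2"
  shows "x \<le> sin (pi * x)"
proof (cases "x \<ge> 1/6")
  case True
  have "sin (pi / 6) \<le> sin (pi * x)"
    using assms True by (intro sin_monotone_2pi_le) (auto simp: field_simps)
  then show ?thesis using assms by (simp add: sin_30)
next
  case False
  show ?thesis
  proof (cases "x = 0")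
    case nz: False
    then have "0 < pi * x" using assms by simp
    from MVT2[OF this, of sin cos] obtain z where z: "0 < z" "z < pi * x" "sin (pi * x) = (pi * x) * cos z"
      by auto
    have "pi * x \<le> pi * (1/6)" using False by (intro mult_left_mono) auto
    then have "z \<le> pi / 6" using z(2) by linarith
    then have "cos (pi / 6) \<le> cos z" using z by (intro cos_monotone_0_pi_le) auto
    moreover have "1 \<le> sqrt 3" by simp
    ultimately have "1/2 \<le> cos z" unfolding cos_30 by linarith
    then have "(2 * x) * (1/2) \<le> (pi * x) * cos z"
      using assms pi_ge_two by (intro mult_mono) auto
    then show ?thesis using z by simp
  qed simp
qed

text \<open>All shifts \<open>S u\<close> are treated together and the kernel is placed near an
  almost extremal one. Since \<open>S\<close> is discontinuous, its supremum need not be attained; a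
  shift \<open>u0\<close> within a factor 2 of it is enough and gives \<open>2 * S0\<close> as a
  bound for all shifts.\<close>

theorem erdos_turan_saw:
  fixes x :: "nat \<Rightarrow> real"
  assumes J: "finite J" and R: "0 < R"
  shows "\<bar>\<Sum>j\<in>J. saw (x j)\<bar> \<le> 40 * real (card J) / R + 4 * (\<Sum>h=1..<R. weyl_sum x J h / real h)"
proof -
  define n where "n = real (card J)"
  define T where "T = (\<Sum>h=1..<R. weyl_sum x J h / real h)"
  define S where "S u = (\<Sum>j\<in>J. saw (x j + u))" for u
  define \<Delta> where "\<Delta> = (SUP u. \<bar>S u\<bar>)"
  have T: "0 \<le> T" unfolding T_def weyl_sum_def by (intro sum_nonneg) auto
  have S_le: "\<bar>S u\<bar> \<le> n / 2" for u
  proof -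
    have "\<bar>S u\<bar> \<le> (\<Sum>j\<in>J. 1/2)" unfolding S_def
      by (intro order_trans[OF sum_abs] sum_mono abs_saw_le)
    then show ?thesis by (simp add: n_def)
  qed
  then have bdd: "bdd_above (range (\<lambda>u. \<bar>S u\<bar>))" by (intro bdd_aboveI[of _ "n/2"]) auto
  have \<Delta>: "\<bar>S u\<bar> \<le> \<Delta>" for u unfolding \<Delta>_def by (rule cSUP_upper[OF _ bdd]) auto
  have S_shift: "S (u + w) \<le> S u + n * w" if "0 \<le> w" for u w
  proof -
    have "S (u + w) \<le> (\<Sum>j\<in>J. saw (x j + u) + w)"
      unfolding S_def using that by (intro sum_mono) (simp add: saw_add_le flip: add.assoc)
    then show ?thesis by (simp add: S_def n_def sum.distrib)
  qed
  have "\<bar>S 0\<bar> \<le> 40 * n / R + 4 * T"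
  proof (cases "\<Delta> \<le> 0")
    case True
    then have "\<bar>S 0\<bar> \<le> 0" using \<Delta>[of 0] by linarith
    moreover have "0 \<le> 40 * n / R" by (simp add: n_def)
    ultimately show ?thesis using T by linarith
  next
    case False
    then have "\<Delta> / 2 < (SUP u. \<bar>S u\<bar>)" by (simp flip: \<Delta>_def)
    then have "\<exists>u\<in>UNIV. \<Delta> / 2 < \<bar>S u\<bar>"
      by (rule less_cSUP_iff[OF UNIV_not_empty bdd, THEN iffD1])
    then obtain u0 where u0: "\<Delta> / 2 < \<bar>S u0\<bar>" by blast
    define S0 where "S0 = \<bar>S u0\<bar>"
    have S0_pos: "0 < S0" using u0 False unfolding S0_def by linarith
    have S_le_S0: "\<bar>S u\<bar> \<le> 2 * S0" for u using \<Delta>[of u] u0 unfolding S0_def by linarith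
    note S0 = S0_pos S_le_S0
    have n: "0 < n" "S0 \<le> n / 2" using S0(1) S_le[of u0] unfolding S0_def by linarith+
    \<comment> \<open>The threshold 20 makes the radius \<open>S0 / (4 * n)\<close> at least
      \<open>5 / R\<close>, so that the kernel is concentrated on the interval where the sum stays
      large. Below the threshold, \<open>2 * S0\<close> is already at most
      \<open>40 * n / R\<close>.\<close>
    show ?thesis
    proof (cases "S0 \<le> 20 * n / R")
      case True
      then show ?thesis using S0(2)[of 0] T by simp
    next
      case big: False
      \<comment> \<open>Since \<open>S\<close> grows at rate at most \<open>n\<close>, a value of size \<open>S0\<close> at \<open>u0\<close> persists with size \<open>S0 / 2\<close> on an
        interval of radius \<open>\<delta>\<close> on one side of \<open>u0\<close>; the average of \<open>S\<close> against the kernel centred there is large.\<close>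
      define \<delta> where "\<delta> = S0 / (4 * n)"
      define \<sigma> where "\<sigma> = (if S u0 > 0 then 1 else -1 :: real)"
      define c where "c = u0 - \<sigma> * \<delta>"
      have \<delta>: "0 < \<delta>" "\<delta> \<le> 1/8" using S0 n by (simp_all add: \<delta>_def divide_le_eq)
      have "(20 * n / R) / (4 * n) \<le> \<delta>"
        unfolding \<delta>_def using big n by (intro divide_right_mono) auto
      then have \<delta>R: "5 / R \<le> \<delta>" using n by simp
      have near: "\<sigma> * S (c + v) \<ge> S0 / 2" if "\<bar>v\<bar> \<le> \<delta>" for v
      proof (cases "S u0 > 0")
        case True
        have "S u0 \<le> S (c + v) + n * (\<delta> - v)"
          using S_shift[of "\<delta> - v" "c + v"] that True by (simp add: c_def \<sigma>_def)
        also have "\<dots> \<le> S (c + v) + n * (2 * \<delta>)" using n that by (intro add_left_mono mult_left_mono) auto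
        finally show ?thesis using True n by (simp add: \<sigma>_def S0_def \<delta>_def)
      next
        case False
        have "S (c + v) \<le> S u0 + n * (\<delta> + v)"
          using S_shift[of "\<delta> + v" "u0"] that False by (simp add: c_def \<sigma>_def add_ac)
        also have "\<dots> \<le> S u0 + n * (2 * \<delta>)" using n that by (intro add_left_mono mult_left_mono) auto
        finally show ?thesis using False n by (simp add: \<sigma>_def S0_def \<delta>_def)
      qed
      \<comment> \<open>Away from the interval only \<open>- 2 * S0\<close> is guaranteed; the
        factor \<open>5/2 = 1/2 + 2\<close> makes up the difference from \<open>S0 / 2\<close>,
        because the quotient of squares is at least 1 there.\<close>
      have far: "\<sigma> * S (c + v) \<ge> S0 / 2 - 5 / 2 * S0 * ((sin (pi * v))\<^sup>2 / \<delta>\<^sup>2)" if "v \<in> {-1/2..1/2}" for v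
      proof (cases "\<bar>v\<bar> \<le> \<delta>")
        case True
        have "0 \<le> 5 / 2 * S0 * ((sin (pi * v))\<^sup>2 / \<delta>\<^sup>2)" using S0 by auto
        then show ?thesis using near[OF True] by linarith
      next
        case False
        have "\<bar>v\<bar> \<le> sin (pi * \<bar>v\<bar>)" using that by (intro sin_pi_ge) auto
        then have "\<delta> \<le> sin (pi * \<bar>v\<bar>)" using False by simp
        then have "\<delta>\<^sup>2 \<le> (sin (pi * \<bar>v\<bar>))\<^sup>2" using \<delta> by (intro power_mono) auto
        also have "\<dots> = (sin (pi * v))\<^sup>2" by (cases "v \<ge> 0") auto
        finally have "1 \<le> (sin (pi * v))\<^sup>2 / \<delta>\<^sup>2" using \<delta> by simp
        then have "5 / 2 * S0 * 1 \<le> 5 / 2 * S0 * ((sin (pi * v))\<^sup>2 / \<delta>\<^sup>2)" using S0 by (intro mult_left_mono) auto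
        moreover have "- (2 * S0) \<le> \<sigma> * S (c + v)" using S0(2)[of "c + v"] by (auto simp: \<sigma>_def)
        ultimately show ?thesis by linarith
      qed
      obtain I where I: "((\<lambda>v. ker R v * (\<Sum>j\<in>J. saw (x j + c + v))) has_integral I) {-1/2..1/2}"
        "\<bar>I\<bar> \<le> ker_mass R * (\<Sum>h=1..<R. weyl_sum x J h / (pi * real h))"
        by (rule ker_saw_integral)
      have lower: "((\<lambda>v. (S0 / 2) * ker R v - (5 / 2 * S0 / \<delta>\<^sup>2) * (ker R v * (sin (pi * v))\<^sup>2)) has_integral
         (S0 / 2) * ker_mass R - (5 / 2 * S0 / \<delta>\<^sup>2) * (real R * ((real R)\<^sup>2 - 1) / 12)) {-1/2..1/2}"
        by (intro has_integral_diff has_integral_mult_right has_integral_ker has_integral_ker_sin2)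
      have "(S0 / 2) * ker_mass R - (5 / 2 * S0 / \<delta>\<^sup>2) * (real R * ((real R)\<^sup>2 - 1) / 12) \<le> \<sigma> * I"
      proof (rule has_integral_le[OF lower has_integral_mult_right[OF I(1)]])
        fix v :: real assume "v \<in> {-1/2..1/2}"
        from mult_left_mono[OF far[OF this] ker_nonneg[of R v]]
        show "(S0 / 2) * ker R v - (5 / 2 * S0 / \<delta>\<^sup>2) * (ker R v * (sin (pi * v))\<^sup>2) \<le> \<sigma> * (ker R v * (\<Sum>j\<in>J. saw (x j + c + v)))"
          by (simp add: S_def algebra_simps)
      qed
      also have "\<dots> \<le> \<bar>I\<bar>" by (auto simp: \<sigma>_def)
      also have "\<dots> \<le> ker_mass R * (\<Sum>h=1..<R. weyl_sum x J h / (pi * real h))" by fact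
      also have "(\<Sum>h=1..<R. weyl_sum x J h / (pi * real h)) = T / pi"
        unfolding T_def sum_divide_distrib by (intro sum.cong) auto
      also have "ker_mass R * (T / pi) \<le> ker_mass R * (T / 2)"
        using T pi_ge_two by (intro mult_left_mono divide_left_mono) (auto simp: ker_mass_def intro: sum_nonneg)
      finally have main: "(S0 / 2) * ker_mass R - (5 / 2 * S0 / \<delta>\<^sup>2) * (real R * ((real R)\<^sup>2 - 1) / 12) \<le> ker_mass R * (T / 2)" .
      have "R > 5" proof -
        have "5 / real R < 1" using \<delta> \<delta>R by linarith
        then show ?thesis using R by (simp add: divide_less_eq)
      qed
      then have R2: "real R ^ 2 > 1" by (simp add: one_less_power)
      \<comment> \<open>The constant 5 is fitted to the two moments:
        \<open>5/24 * 1/25 = 1/120\<close>, so the second moment consumes at most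
        \<open>S0 / 4\<close> of the \<open>S0 / 2\<close> times \<open>ker_mass R\<close>
        available.\<close>
      have "1 / \<delta>\<^sup>2 \<le> 1 / (5 / R)\<^sup>2"
        using \<delta> \<delta>R R by (intro divide_left_mono power_mono) auto
      then have "1 / \<delta>\<^sup>2 \<le> (real R)\<^sup>2 / 25" by (simp add: power_divide)
      moreover define X where "X = S0 * (real R * ((real R)\<^sup>2 - 1))"
      have "0 \<le> X" using S0(1) R2 by (simp add: X_def)
      ultimately have "X * 5 / 24 * (1 / \<delta>\<^sup>2) \<le> X * 5 / 24 * ((real R)\<^sup>2 / 25)"
        by (intro mult_left_mono) auto
      also have "\<dots> \<le> X * ((real R)\<^sup>2 + 1) / 120"
        using \<open>0 \<le> X\<close> by (simp add: distrib_left)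
      also have "\<dots> = S0 / 4 * ker_mass R"
        unfolding ker_mass_eq X_def by (simp add: field_simps power2_eq_square power4_eq_xxxx)
      also have "X * 5 / 24 * (1 / \<delta>\<^sup>2) = (5 / 2 * S0 / \<delta>\<^sup>2) * (real R * ((real R)\<^sup>2 - 1) / 12)"
        by (simp add: X_def)
      finally have small: "(5 / 2 * S0 / \<delta>\<^sup>2) * (real R * ((real R)\<^sup>2 - 1) / 12) \<le> S0 / 4 * ker_mass R" .
      have "a - Z \<le> b \<Longrightarrow> Z \<le> e \<Longrightarrow> a = e + e \<Longrightarrow> e \<le> b" for a b e Z :: real by linarith
      from this[OF main small] have "S0 / 4 * ker_mass R \<le> T / 2 * ker_mass R"
        by (simp only: mult.commute)
      moreover have "0 < ker_mass R"
      proof -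
        have "1 < real R ^ 4" using \<open>R > 5\<close> by (intro one_less_power) auto
        then show ?thesis unfolding ker_mass_eq using R by simp
      qed
      ultimately have "S0 / 4 \<le> T / 2" by (rule mult_right_le_imp_le)
      moreover have "0 \<le> 40 * n / R" using n by simp
      ultimately show ?thesis using S0(2)[of 0] by linarith
    qed
  qed
  then show ?thesis by (simp add: S_def n_def T_def)
qed

subsection \<open>Exponential sums\<close>

text \<open>Increments that increase and stay between two neighbouring integers make the cotangents
  \<open>c j\<close> decreasing, so their total variation is a difference of two end values, each at
  most \<open>1 / \<delta>\<close> in modulus. The last increment involves \<open>x b\<close>, a
  point outside the sum, so no term is left over at the end.\<close>

lemma kuzmin_landau:
  fixes x :: "nat \<Rightarrow> real" and m :: int and \<delta> :: real
  assumes mono: "\<And>j. a \<le> j \<Longrightarrow> Suc j < b \<Longrightarrow> x (Suc j) - x j \<le> x (Suc (Suc j)) - x (Suc j)"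
    and range: "\<And>j. a \<le> j \<Longrightarrow> j < b \<Longrightarrow> of_int m + \<delta> \<le> x (Suc j) - x j \<and> x (Suc j) - x j \<le> of_int m + 1 - \<delta>"
    and \<delta>: "0 < \<delta>"
  shows "norm (\<Sum>j=a..<b. cis (2 * pi * x j)) \<le> 3 / \<delta>"
proof (cases "a < b")
  case False
  then show ?thesis using \<delta> by simp
next
  case True
  define E where "E j = cis (2 * pi * x j)" for j
  define y where "y j = pi * (x (Suc j) - x j - m)" for j
  \<comment> \<open>\<open>w j = 1 / (cis (2 * y j) - 1)\<close> turns each term into a difference; its real part is constant and its
    imaginary part is monotone, so the partial summation telescopes.\<close>
  define c where "c j = cos (y j) / sin (y j)" for j
  define w where "w j = Complex (-1/2) (- c j / 2)" for j
  have \<delta>2: "\<delta> \<le> 1/2" using range[of a] True by auto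
  have sin_y: "\<delta> \<le> sin (y j)" and y: "0 < y j" "y j < pi" if "a \<le> j" "j < b" for j
  proof -
    define t where "t = x (Suc j) - x j - m"
    have t: "\<delta> \<le> t" "t \<le> 1 - \<delta>" using range[OF that] by (auto simp: t_def)
    have "pi * 0 < pi * t" "pi * t < pi * 1" using t \<delta> by (intro mult_strict_left_mono; simp)+
    then show "0 < y j" "y j < pi" by (auto simp: y_def t_def)
    show "\<delta> \<le> sin (y j)"
    proof (cases "t \<le> 1/2")
      case True
      then show ?thesis using sin_pi_ge[of t] t \<delta> by (simp add: y_def t_def)
    next
      case False
      then have "1 - t \<le> sin (pi * (1 - t))" using t \<delta> by (intro sin_pi_ge) auto
      also have "pi * (1 - t) = pi - y j" by (simp add: y_def t_def right_diff_distrib)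
      finally show ?thesis using t by simp
    qed
  qed
  have w_eq: "w j * (cis (2 * pi * (x (Suc j) - x j)) - 1) = 1" if "a \<le> j" "j < b" for j
  proof -
    have "2 * pi * (x (Suc j) - x j) = 2 * y j + 2 * pi * of_int m"
      by (simp add: y_def algebra_simps)
    then have "cis (2 * pi * (x (Suc j) - x j)) = cis (2 * y j) * cis (2 * pi * of_int m)"
      by (simp only: cis_mult)
    also have "cis (2 * pi * real_of_int m) = 1" by (rule cis_multiple_2pi) simp
    finally have *: "cis (2 * pi * (x (Suc j) - x j)) = cis (2 * y j)" by simp
    have "sin (y j) \<noteq> 0" using sin_y[OF that] \<delta> by auto
    moreover have "cos (y j) * cos (y j) = 1 - sin (y j) * sin (y j)"
      using sin_cos_squared_add[of "y j"] by (simp add: power2_eq_square)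
    moreover from calculation have "c j * sin (y j) = cos (y j)" by (simp add: c_def)
    moreover note cos_double_sin[of "y j", unfolded power2_eq_square] sin_double[of "y j"]
    ultimately have "- 1/2 * (cos (2 * y j) - 1) - (- c j / 2) * sin (2 * y j) = 1"
      "- 1/2 * sin (2 * y j) + (- c j / 2) * (cos (2 * y j) - 1) = 0"
      by algebra+
    then show ?thesis unfolding * by (simp add: complex_eq_iff w_def)
  qed
  have step: "E (Suc j) = E j * cis (2 * pi * (x (Suc j) - x j))" for j
    unfolding E_def cis_mult by (rule arg_cong[of _ _ cis]) (simp add: algebra_simps)
  have key: "E j - w j * E (Suc j) = - w j * E j" if "a \<le> j" "j < b" for j
    using w_eq[OF that] unfolding step by algebra
  have c_mono: "c (Suc j) \<le> c j" if "a \<le> j" "Suc j < b" for j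
  proof -
    have "y j \<le> y (Suc j)" using mono[OF that] by (auto simp: y_def intro!: mult_left_mono)
    then have "0 \<le> sin (y (Suc j) - y j)"
      using y[of j] y[of "Suc j"] that by (intro sin_ge_zero) auto
    then have "cos (y (Suc j)) * sin (y j) \<le> cos (y j) * sin (y (Suc j))"
      by (simp add: sin_diff mult.commute)
    then show ?thesis unfolding c_def using sin_y[of j] sin_y[of "Suc j"] that \<delta>
      by (intro frac_le_eq[THEN iffD2] divide_nonpos_pos) (auto)
  qed
  have bound: "norm ((\<Sum>j=a..<a + Suc n. E j) - w (a + n) * E (a + Suc n) + w a * E a) \<le> (c a - c (a + n)) / 2"
    if "a + n < b" for n
    using that
  proof (induction n)
    case 0
    then show ?case using key[of a] by simp
  next
    case (Suc n)
    have "(\<Sum>j=a..<a + Suc (Suc n). E j) - w (a + Suc n) * E (a + Suc (Suc n)) + w a * E a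
      = ((\<Sum>j=a..<a + Suc n. E j) - w (a + n) * E (a + Suc n) + w a * E a) + (w (a + n) - w (a + Suc n)) * E (a + Suc n)"
      using key[of "a + Suc n"] Suc.prems by (simp add: algebra_simps)
    also have "norm \<dots> \<le> (c a - c (a + n)) / 2 + norm (w (a + n) - w (a + Suc n))"
      using Suc by (intro norm_triangle_mono) (simp_all add: norm_mult E_def)
    also have "norm (w (a + n) - w (a + Suc n)) = (c (a + n) - c (a + Suc n)) / 2"
      using c_mono[of "a + n"] Suc.prems by (simp add: w_def complex_diff cmod_def)
    finally show ?case by (simp add: diff_divide_distrib)
  qed
  have c_le: "\<bar>c j\<bar> \<le> 1 / \<delta>" if "a \<le> j" "j < b" for j
  proof -
    have "\<bar>cos (y j)\<bar> / \<bar>sin (y j)\<bar> \<le> 1 / \<delta>"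
      using sin_y[OF that] \<delta> by (intro frac_le) auto
    then show ?thesis by (simp add: c_def)
  qed
  have w_le: "norm (w j) \<le> 3 / (4 * \<delta>)" if "a \<le> j" "j < b" for j
  proof -
    have "norm (w j) \<le> 1/2 + \<bar>c j\<bar> / 2" using cmod_le[of "w j"] by (simp add: w_def)
    also have "\<dots> \<le> 1/2 + 1 / \<delta> / 2" using c_le[OF that] by simp
    also have "1/2 \<le> 1 / (4 * \<delta>)" using \<delta> \<delta>2 by (simp add: field_simps)
    finally show ?thesis using \<delta> by (simp add: field_simps)
  qed
  obtain n where n: "b = a + Suc n" using True less_iff_Suc_add by auto
  let ?S = "\<Sum>j=a..<b. E j"
  have "norm ?S \<le> norm (?S - w (a + n) * E b + w a * E a) + norm (w (a + n) * E b) + norm (w a * E a)"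
    using norm_triangle_ineq4[of "(?S - w (a + n) * E b + w a * E a) + w (a + n) * E b" "w a * E a"]
      norm_triangle_ineq[of "?S - w (a + n) * E b + w a * E a" "w (a + n) * E b"] by simp
  also have "\<dots> \<le> (1 / \<delta> + 1 / \<delta>) / 2 + 3 / (4 * \<delta>) + 3 / (4 * \<delta>)"
    using bound[of n] c_le[of a] c_le[of "a + n"] w_le[of a] w_le[of "a + n"] n
    by (intro add_mono) (auto simp: norm_mult E_def)
  also have "\<dots> \<le> 3 / \<delta>" using \<delta> by (simp add: field_simps)
  finally show ?thesis by (simp add: E_def)
qed

text \<open>Locates where increasing increments cross a given level; the sentinel
  \<open>j = b\<close> in \<open>Q\<close> covers the case that they never do.\<close>

lemma threshold_exists:
  fixes P :: "nat \<Rightarrow> bool"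
  assumes "a \<le> b" "\<And>j. a \<le> j \<Longrightarrow> Suc j < b \<Longrightarrow> P (Suc j) \<Longrightarrow> P j"
  obtains p where "a \<le> p" "p \<le> b" "\<And>j. a \<le> j \<Longrightarrow> j < b \<Longrightarrow> P j \<longleftrightarrow> j < p"
proof -
  define Q where "Q j \<longleftrightarrow> a \<le> j \<and> (j = b \<or> \<not> P j)" for j
  define p where "p = (LEAST j. Q j)"
  have Qb: "Q b" using assms(1) by (simp add: Q_def)
  then have Qp: "Q p" unfolding p_def by (rule LeastI)
  show ?thesis
  proof (rule that[of p])
    show "a \<le> p" using Qp by (simp add: Q_def)
    show "p \<le> b" unfolding p_def using Qb by (rule Least_le)
    show "P j \<longleftrightarrow> j < p" if "a \<le> j" "j < b" for j
    proof (cases "j < p")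
      case True
      then have "\<not> Q j" unfolding p_def by (rule not_less_Least)
      then show ?thesis using that True by (simp add: Q_def)
    next
      case False
      then have "p \<le> j" by simp
      then have "j < b \<longrightarrow> \<not> P j"
      proof (induction j rule: dec_induct)
        case base
        then show ?case using Qp by (auto simp: Q_def)
      next
        case (step j)
        then show ?case using assms(2)[of j] \<open>a \<le> p\<close> by auto
      qed
      then show ?thesis using that False by simp
    qed
  qed
qed

text \<open>The range condition leaves \<open>m\<close> as the only integer that the increments can
  approach within \<open>\<delta> = sqrt \<epsilon>\<close>, since
  \<open>\<delta> \<le> 1/4\<close>. Steps of at least \<open>\<epsilon>\<close> leave at most
  \<open>2 * \<delta> / \<epsilon> + 1\<close> increments in that window, which are estimated
  trivially by \<open>3 / \<delta>\<close>; on either side Kuzmin-Landau gives another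
  \<open>3 / \<delta>\<close>.\<close>

lemma van_der_corput:
  fixes x :: "nat \<Rightarrow> real" and m :: int and \<epsilon> :: real
  assumes incr: "\<And>j. a \<le> j \<Longrightarrow> Suc j < b \<Longrightarrow> x (Suc j) - x j + \<epsilon> \<le> x (Suc (Suc j)) - x (Suc j)"
    and range: "\<And>j. a \<le> j \<Longrightarrow> j < b \<Longrightarrow> \<bar>x (Suc j) - x j - m\<bar> \<le> 3/4"
    and \<epsilon>: "0 < \<epsilon>" "\<epsilon> \<le> 1/16"
  shows "norm (\<Sum>j=a..<b. cis (2 * pi * x j)) \<le> 9 / sqrt \<epsilon>"
proof (cases "a \<le> b")
  case False
  then show ?thesis using \<epsilon> by simp
next
  case ab: True
  define d where "d j = x (Suc j) - x j" for j
  define \<delta> where "\<delta> = sqrt \<epsilon>"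
  have \<delta>: "0 < \<delta>" "\<delta> \<le> 1/4" "\<delta> * \<delta> = \<epsilon>"
    using \<epsilon> real_sqrt_le_mono[OF \<epsilon>(2)] by (auto simp: \<delta>_def real_sqrt_divide)
  have d: "d j + \<epsilon> \<le> d (Suc j)" if "a \<le> j" "Suc j < b" for j using incr[OF that] by (simp add: d_def)
  obtain p where p: "a \<le> p" "p \<le> b" "\<And>j. a \<le> j \<Longrightarrow> j < b \<Longrightarrow> d j < m - \<delta> \<longleftrightarrow> j < p"
    by (rule threshold_exists[of a b "\<lambda>j. d j < m - \<delta>"]) (use ab d \<epsilon> in force)+
  obtain q where q: "a \<le> q" "q \<le> b" "\<And>j. a \<le> j \<Longrightarrow> j < b \<Longrightarrow> d j < m + \<delta> \<longleftrightarrow> j < q"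
    by (rule threshold_exists[of a b "\<lambda>j. d j < m + \<delta>"]) (use ab d \<epsilon> in force)+
  have pq: "p \<le> q"
  proof (rule ccontr)
    assume "\<not> p \<le> q"
    then have "d q < m - \<delta>" "\<not> d q < m + \<delta>" using p(2) p(3)[of q] q(1) q(3)[of q] by auto
    then show False using \<delta> by linarith
  qed
  have grow: "d (p + i) \<ge> d p + real i * \<epsilon>" if "p + i < b" for i
    using that
  proof (induction i)
    case (Suc i)
    then have "d p + real i * \<epsilon> \<le> d (p + i)" by simp
    also have "\<dots> + \<epsilon> \<le> d (p + Suc i)" using d[of "p + i"] p(1) Suc.prems by simp
    finally show ?case by (simp add: distrib_right)
  qed simp
  have mid: "real (q - p) \<le> 3 / \<delta>"
  proof (cases "p = q")
    case False
    define i where "i = q - p - 1"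
    have i: "p + i < q" "q - p = Suc i" using pq False by (auto simp: i_def)
    have "\<not> d p < m - \<delta>" "d (p + i) < m + \<delta>" using p(1) p(3)[of p] q(2) q(3)[of "p + i"] i(1) by auto
    then have "real i * (\<delta> * \<delta>) \<le> 2 * \<delta>" using grow[of i] i(1) q(2) \<delta>(3) by simp
    then have "real i * \<delta> \<le> 2" using \<delta>(1) by (simp flip: mult.assoc)
    then show ?thesis using \<delta> i by (simp add: field_simps)
  qed (use \<delta> in auto)
  have 1: "norm (\<Sum>j=a..<p. cis (2 * pi * x j)) \<le> 3 / \<delta>"
  proof (rule kuzmin_landau[where m = "m - 1" and x = x and a = a and b = p and \<delta> = \<delta>])
    show "real_of_int (m - 1) + \<delta> \<le> x (Suc j) - x j \<and> x (Suc j) - x j \<le> real_of_int (m - 1) + 1 - \<delta>" if "a \<le> j" "j < p" for j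
    proof -
      have "d j < m - \<delta>" "\<bar>d j - m\<bar> \<le> 3/4"
        using p(2) p(3)[of j] range[of j] that by (auto simp: d_def)
      then show ?thesis using \<delta>(2) unfolding d_def of_int_diff of_int_1 by linarith
    qed
    show "x (Suc j) - x j \<le> x (Suc (Suc j)) - x (Suc j)" if "a \<le> j" "Suc j < p" for j
      using d[of j] that p(2) \<epsilon>(1) by (simp add: d_def)
  qed (rule \<delta>(1))
  have 2: "norm (\<Sum>j=q..<b. cis (2 * pi * x j)) \<le> 3 / \<delta>"
  proof (rule kuzmin_landau[where m = m and x = x and a = q and b = b and \<delta> = \<delta>])
    show "real_of_int m + \<delta> \<le> x (Suc j) - x j \<and> x (Suc j) - x j \<le> real_of_int m + 1 - \<delta>" if "q \<le> j" "j < b" for j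
    proof -
      have "\<not> d j < m + \<delta>" "\<bar>d j - m\<bar> \<le> 3/4"
        using q(1) q(3)[of j] range[of j] that by (auto simp: d_def)
      then show ?thesis using \<delta>(2) unfolding d_def of_int_diff of_int_1 by linarith
    qed
    show "x (Suc j) - x j \<le> x (Suc (Suc j)) - x (Suc j)" if "q \<le> j" "Suc j < b" for j
      using d[of j] that q(1) \<epsilon>(1) by (simp add: d_def)
  qed (rule \<delta>(1))
  have "norm (\<Sum>j=p..<q. cis (2 * pi * x j)) \<le> (\<Sum>j=p..<q. 1)"
    by (intro order_trans[OF norm_sum] sum_mono) auto
  then have 3: "norm (\<Sum>j=p..<q. cis (2 * pi * x j)) \<le> 3 / \<delta>" using mid by simp
  have "(\<Sum>j=a..<b. cis (2 * pi * x j)) = (\<Sum>j=a..<p. cis (2 * pi * x j)) + (\<Sum>j=p..<q. cis (2 * pi * x j)) + (\<Sum>j=q..<b. cis (2 * pi * x j))"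
    using p q pq by (simp add: sum.atLeastLessThan_concat)
  also have "norm \<dots> \<le> 3 / \<delta> + 3 / \<delta> + 3 / \<delta>"
    by (intro norm_triangle_mono 1 2 3)
  finally show ?thesis by (simp add: \<delta>_def)
qed

subsection \<open>Badly approximable numbers\<close>

text \<open>Four times the form is \<open>(2 * m + h)^2 - 5 * h^2\<close>. If it vanished, the prime
  5 would occur to an even power on one side and to an odd power on the other.\<close>

lemma golden_form_nonzero:
  fixes m h :: int
  assumes "h \<noteq> 0"
  shows "m\<^sup>2 + m * h - h\<^sup>2 \<noteq> 0"
proof
  assume "m\<^sup>2 + m * h - h\<^sup>2 = 0"
  then have eq: "(2 * m + h)\<^sup>2 = 5 * h\<^sup>2" by algebra
  have p: "prime (5::int)" by simp
  have nz: "2 * m + h \<noteq> 0" using eq assms by auto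
  have "multiplicity 5 ((2 * m + h)\<^sup>2) = 2 * multiplicity 5 (2 * m + h)"
    using p nz by (simp add: prime_elem_multiplicity_power_distrib)
  moreover have "multiplicity 5 (5 * h\<^sup>2) = 1 + 2 * multiplicity 5 h"
    using p assms by (simp add: prime_elem_multiplicity_mult_distrib prime_elem_multiplicity_power_distrib)
  ultimately have "2 * multiplicity 5 (2 * m + h) = 1 + 2 * multiplicity 5 h" using eq by simp
  then show False by presburger
qed

lemma fib_golden_form:
  assumes "1 \<le> k"
  shows "\<bar>(real (fib (k - 1)))\<^sup>2 + real (fib (k - 1)) * real (fib k) - (real (fib k))\<^sup>2\<bar> = 1"
proof -
  obtain n where k: "k = Suc n" using assms by (cases k) auto
  have "\<bar>(int (fib n))\<^sup>2 + int (fib n) * int (fib (Suc n)) - (int (fib (Suc n)))\<^sup>2\<bar> = 1"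
  proof -
    have "(int (fib n))\<^sup>2 + int (fib n) * int (fib (Suc n)) - (int (fib (Suc n)))\<^sup>2 = - ((- 1) ^ n)"
      using fib_Cassini_int[of n] by (simp add: algebra_simps power2_eq_square)
    then show ?thesis by simp
  qed
  then have "real_of_int \<bar>(int (fib n))\<^sup>2 + int (fib n) * int (fib (Suc n)) - (int (fib (Suc n)))\<^sup>2\<bar> = 1"
    by simp
  then show ?thesis by (simp add: k)
qed

text \<open>The form \<open>m\<^sup>2 + m h - h\<^sup>2\<close> is a nonzero integer, while Cassini's identity makes it almost vanish on
  the line through \<open>(fib (k - 1), fib k)\<close>; hence \<open>m / h\<close> stays away from \<open>fib (k - 1) / fib k\<close>.\<close>

lemma fib_ratio_badly_approximable:
  fixes h k :: nat and m :: int
  assumes k: "1 \<le> k" and h: "0 < h" "2 * h \<le> fib k"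
  shows "1 / (8 * real h) \<le> \<bar>real h * (real (fib (k - 1)) / real (fib k)) - of_int m\<bar>"
proof -
  define M where "M = real (fib k)"
  define \<alpha> where "\<alpha> = real (fib (k - 1)) / M"
  have M: "0 < M" "2 * real h \<le> M" using h unfolding M_def by linarith+
  have "fib (k - 1) \<le> fib k" by (rule fib_mono) simp
  then have \<alpha>: "0 \<le> \<alpha>" "\<alpha> \<le> 1" using M by (auto simp: \<alpha>_def M_def)
  show ?thesis
  proof (rule ccontr)
    assume "\<not> ?thesis"
    then have less: "\<bar>h * \<alpha> - m\<bar> < 1 / (8 * real h)" by (simp add: \<alpha>_def M_def)
    have "1 \<le> \<bar>m\<^sup>2 + m * int h - (int h)\<^sup>2\<bar>"
      using golden_form_nonzero[of "int h" m] h by linarith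
    then have "1 \<le> real_of_int \<bar>m\<^sup>2 + m * int h - (int h)\<^sup>2\<bar>" by linarith
    then have 1: "1 \<le> \<bar>(of_int m)\<^sup>2 + of_int m * real h - (real h)\<^sup>2\<bar>" by simp
    \<comment> \<open>This is the form at \<open>(h \<alpha>, h)\<close>, a multiple of
      \<open>(fib (k - 1), fib k)\<close> by \<open>h / M\<close>. By homogeneity its modulus is
      \<open>(h / M)^2\<close>, and \<open>2 h \<le> M\<close> gives the \<open>1/4\<close>.\<close>
    have "(real h)\<^sup>2 * (\<alpha>\<^sup>2 + \<alpha> - 1) = (real h / M)\<^sup>2 * ((\<alpha> * M)\<^sup>2 + (\<alpha> * M) * M - M\<^sup>2)"
      using M by (simp add: field_simps power2_eq_square)
    also have "\<bar>\<dots>\<bar> = (real h / M)\<^sup>2"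
      using fib_golden_form[OF k] M by (simp add: \<alpha>_def M_def abs_mult)
    also have "\<dots> \<le> (1/2)\<^sup>2" using M by (intro power_mono) (auto simp: divide_le_eq)
    finally have 2: "\<bar>(real h)\<^sup>2 * (\<alpha>\<^sup>2 + \<alpha> - 1)\<bar> \<le> 1/4" by (simp add: power2_eq_square)
    \<comment> \<open>The values of the form at \<open>m\<close> and at \<open>h \<alpha>\<close>
      differ by at least \<open>1 - 1/4\<close>, and the difference contains the factor
      \<open>h \<alpha> - m\<close>. The other factor is at most \<open>4 h\<close>, so a distance
      below \<open>1 / (8 h)\<close> would give only \<open>1/2\<close>.\<close>
    have "((of_int m)\<^sup>2 + of_int m * real h - (real h)\<^sup>2) - (real h)\<^sup>2 * (\<alpha>\<^sup>2 + \<alpha> - 1)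
        = - ((h * \<alpha> - m) * (of_int m + h * \<alpha> + real h))"
      by (simp add: algebra_simps power2_eq_square)
    then have 3: "3/4 \<le> \<bar>h * \<alpha> - m\<bar> * \<bar>of_int m + h * \<alpha> + real h\<bar>"
      using 1 2 unfolding abs_mult[symmetric] by linarith
    have "1 / (8 * real h) \<le> 1" using h by simp
    then have "\<bar>h * \<alpha> - m\<bar> < 1" using less by linarith
    moreover have "0 \<le> h * \<alpha>" "h * \<alpha> \<le> real h * 1" using \<alpha> by (simp, intro mult_left_mono) auto
    ultimately have "\<bar>of_int m + h * \<alpha> + real h\<bar> \<le> 4 * real h" using h by linarith
    then have "\<bar>h * \<alpha> - m\<bar> * \<bar>of_int m + h * \<alpha> + real h\<bar> \<le> 1 / (8 * real h) * (4 * real h)"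
      using less by (intro mult_mono) auto
    also have "\<dots> = 1/2" using h by simp
    finally show False using 3 by linarith
  qed
qed

section \<open>Spacing of the multiples of a badly approximable number within a dyadic block\<close>

definition dist_int :: "real \<Rightarrow> real" where "dist_int x = \<bar>x - of_int (round x)\<bar>"

lemma sum_inverse_squares_int_le:
  assumes "finite (I :: int set)"
  shows "(\<Sum>i\<in>I. 1 / (real_of_int (\<bar>i\<bar> + 1))\<^sup>2) \<le> 4"
proof -
  define f where "f i = 1 / (real_of_int (\<bar>i\<bar> + 1))\<^sup>2" for i
  have f: "0 \<le> f i" for i by (simp add: f_def)
  obtain n where n: "I \<subseteq> {- int n..int n}"
  proof -
    have "I \<subseteq> {- int (nat (Max (abs ` insert 0 I)))..int (nat (Max (abs ` insert 0 I)))}"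
    proof
      fix i assume "i \<in> I"
      then have "\<bar>i\<bar> \<le> Max (abs ` insert 0 I)" using assms by (intro Max_ge) auto
      then show "i \<in> {- int (nat (Max (abs ` insert 0 I)))..int (nat (Max (abs ` insert 0 I)))}" by auto
    qed
    then show ?thesis by (rule that)
  qed
  \<comment> \<open>The remainder \<open>2 / (n + 1)\<close> makes the induction telescope and gives
    equality at \<open>n = 0\<close>.\<close>
  have step: "(\<Sum>i\<in>{- int n..int n}. f i) \<le> 3 - 2 / (real n + 1)" for n
  proof (induction n)
    case (Suc n)
    have "{- int (Suc n)..int (Suc n)} = insert (- int (Suc n)) (insert (int (Suc n)) {- int n..int n})" by auto
    then have "(\<Sum>i\<in>{- int (Suc n)..int (Suc n)}. f i) = 2 / (real n + 2)\<^sup>2 + (\<Sum>i\<in>{- int n..int n}. f i)"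
      by (simp add: f_def add_ac)
    also have "2 / (real n + 2)\<^sup>2 \<le> 2 / ((real n + 1) * (real n + 2))"
      by (intro divide_left_mono) (auto simp: power2_eq_square intro!: mult_right_mono)
    also have "\<dots> = 2 / (real n + 1) - 2 / (real n + 2)"
      by (simp add: field_simps)
    finally show ?case using Suc by (simp add: add_ac)
  qed (simp add: f_def)
  have "(\<Sum>i\<in>I. f i) \<le> (\<Sum>i\<in>{- int n..int n}. f i)" using n f by (intro sum_mono2) auto
  also have "\<dots> \<le> 4" using step[of n] by (smt (verit) divide_nonneg_nonneg of_nat_0_le_iff)
  finally show ?thesis by (simp add: f_def)
qed

text \<open>The factor 4 is forced by \<open>u = -1/2\<close>, where the floor is \<open>-1\<close>
  and equality holds.\<close>

lemma abs_floor_le: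
  fixes u :: real
  assumes "1/2 \<le> \<bar>u\<bar>"
  shows "real_of_int (\<bar>\<lfloor>u\<rfloor>\<bar> + 1) / 4 \<le> \<bar>u\<bar>"
proof (cases "\<lfloor>u\<rfloor> \<le> -2")
  case True
  then have "\<bar>\<lfloor>u\<rfloor>\<bar> = - \<lfloor>u\<rfloor>" "u < - 1" by linarith+
  moreover have "u - 1 < of_int \<lfloor>u\<rfloor>" by linarith
  moreover have "real_of_int (\<bar>\<lfloor>u\<rfloor>\<bar> + 1) = 1 - of_int \<lfloor>u\<rfloor>" using calculation(1) by simp
  moreover have "(1 - real_of_int \<lfloor>u\<rfloor>) / 4 \<le> - u" using calculation(2,3) by (simp add: field_simps)
  ultimately show ?thesis by simp
next
  case False
  then have "0 \<le> u \<or> \<lfloor>u\<rfloor> = -1" by linarith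
  then show ?thesis
  proof
    assume "0 \<le> u"
    then have "\<bar>\<lfloor>u\<rfloor>\<bar> = \<lfloor>u\<rfloor>" by simp
    moreover have "1/2 \<le> u" using assms \<open>0 \<le> u\<close> by simp
    then have "x \<le> u \<Longrightarrow> (x + 1) / 4 \<le> u" for x by (simp add: field_simps)
    then have "(real_of_int \<lfloor>u\<rfloor> + 1) / 4 \<le> u" using of_int_floor_le by blast
    ultimately show ?thesis using \<open>0 \<le> u\<close> by simp
  qed (use assms in simp)
qed

context
  fixes \<alpha> c :: real and D :: nat
  assumes c: "0 < c" and D: "0 < D"
    and bad: "\<And>h m. 0 < h \<Longrightarrow> h < 2 * D \<Longrightarrow> c / real h \<le> \<bar>real h * \<alpha> - of_int m\<bar>"
begin

text \<open>Two frequencies of the block differ by less than \<open>D\<close>, so \<open>bad\<close>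
  applied to their difference separates the signed distances \<open>\<theta>\<close> by more than
  \<open>c / D\<close>. Cells of that width therefore hold at most one frequency each, and
  \<open>i h\<close> is the cell number. Applying \<open>bad\<close> to \<open>h\<close> itself
  bounds the cells next to 0 away from zero.\<close>

lemma dyadic_index:
  obtains i :: "nat \<Rightarrow> int" where "inj_on i {D..<2*D}"
    "\<forall>h\<in>{D..<2*D}. c / (4 * D) * real_of_int (\<bar>i h\<bar> + 1) \<le> dist_int (h * \<alpha>)"
proof
  define \<theta> where "\<theta> h = h * \<alpha> - of_int (round (h * \<alpha>))" for h :: nat
  define i where "i h = \<lfloor>D * \<theta> h / c\<rfloor>" for h :: nat
  have sep: "c / D < \<bar>\<theta> h' - \<theta> h\<bar>" if "h \<in> {D..<2*D}" "h' \<in> {D..<2*D}" "h < h'" for h h'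
  proof -
    have "c / D < c / real (h' - h)" using that c D by (intro divide_strict_left_mono) auto
    also have "\<dots> \<le> \<bar>real (h' - h) * \<alpha> - of_int (round (h' * \<alpha>) - round (h * \<alpha>))\<bar>"
      using that by (intro bad) auto
    also have "\<dots> = \<bar>\<theta> h' - \<theta> h\<bar>" using that by (simp add: \<theta>_def of_nat_diff algebra_simps)
    finally show ?thesis .
  qed
  have inj: "i h \<noteq> i h'" if "h \<in> {D..<2*D}" "h' \<in> {D..<2*D}" "h < h'" for h h'
  proof
    assume "i h = i h'"
    then have "\<bar>D * \<theta> h' / c - D * \<theta> h / c\<bar> < 1" unfolding i_def by linarith
    also have "D * \<theta> h' / c - D * \<theta> h / c = (D / c) * (\<theta> h' - \<theta> h)" by (simp add: right_diff_distrib)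
    finally have "(D / c) * \<bar>\<theta> h' - \<theta> h\<bar> < 1" using c by (simp add: abs_mult)
    moreover have "(D / c) * (c / D) < (D / c) * \<bar>\<theta> h' - \<theta> h\<bar>"
      using sep[OF that] c D by (intro mult_strict_left_mono) auto
    ultimately show False using c D by simp
  qed
  show "inj_on i {D..<2*D}"
    using inj by (intro linorder_inj_onI) auto
  show "\<forall>h\<in>{D..<2*D}. c / (4 * D) * real_of_int (\<bar>i h\<bar> + 1) \<le> dist_int (h * \<alpha>)"
  proof
    fix h assume h: "h \<in> {D..<2*D}"
    have "c / (2 * D) \<le> c / h" using h c D by (intro divide_left_mono) auto
    also have "\<dots> \<le> \<bar>\<theta> h\<bar>" unfolding \<theta>_def using h D by (intro bad) auto
    finally have "(D / c) * (c / (2 * D)) \<le> (D / c) * \<bar>\<theta> h\<bar>" using c by (intro mult_left_mono) auto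
    then have "1/2 \<le> (D / c) * \<bar>\<theta> h\<bar>" using c D by simp
    moreover have "(D / c) * \<bar>\<theta> h\<bar> = \<bar>D * \<theta> h / c\<bar>" using c by (simp add: abs_mult)
    ultimately have "real_of_int (\<bar>i h\<bar> + 1) / 4 \<le> (D / c) * \<bar>\<theta> h\<bar>"
      unfolding i_def using abs_floor_le by metis
    then have "(c / D) * (real_of_int (\<bar>i h\<bar> + 1) / 4) \<le> (c / D) * ((D / c) * \<bar>\<theta> h\<bar>)"
      using c by (intro mult_left_mono) auto
    then show "c / (4 * D) * real_of_int (\<bar>i h\<bar> + 1) \<le> dist_int (h * \<alpha>)"
      using c D by (simp add: dist_int_def \<theta>_def)
  qed
qed

lemma dist_int_pos:
  assumes "h \<in> {D..<2*D}"
  shows "0 < dist_int (h * \<alpha>)"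
proof -
  have "0 < c / h" using assms c D by auto
  also have "\<dots> \<le> dist_int (h * \<alpha>)" unfolding dist_int_def using assms D by (intro bad) auto
  finally show ?thesis .
qed

text \<open>The sum is really of order \<open>D log D\<close>; the weaker bound is all that is needed and follows from the
  convergent sum of inverse squares by AM-GM.\<close>

lemma sum_inverse_dist_int_le:
  assumes "G \<subseteq> {D..<2*D}"
  shows "(\<Sum>h\<in>G. 1 / dist_int (h * \<alpha>)) \<le> (1 + 64 / c\<^sup>2) * (D * sqrt D)"
proof -
  obtain i where i: "inj_on i {D..<2*D}"
    "\<forall>h\<in>{D..<2*D}. c / (4 * D) * real_of_int (\<bar>i h\<bar> + 1) \<le> dist_int (h * \<alpha>)"
    by (rule dyadic_index)
  have "(\<Sum>h\<in>G. 1 / dist_int (h * \<alpha>)) \<le> (\<Sum>h\<in>{D..<2*D}. 1 / dist_int (h * \<alpha>))"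
    using assms dist_int_pos by (intro sum_mono2) (auto intro: less_imp_le)
  also have "\<dots> \<le> (\<Sum>h\<in>{D..<2*D}. sqrt D + 16 * (D * sqrt D) / c\<^sup>2 * (1 / (real_of_int (\<bar>i h\<bar> + 1))\<^sup>2))"
  proof (rule sum_mono)
    fix h assume h: "h \<in> {D..<2*D}"
    define \<theta> where "\<theta> = dist_int (h * \<alpha>)"
    have \<theta>: "0 < \<theta>" using dist_int_pos[OF h] by (simp add: \<theta>_def)
    have s: "0 < sqrt D" "sqrt D * sqrt D = D" using D by auto
    define s where "s = sqrt D"
    \<comment> \<open>The weight \<open>s = sqrt D\<close> balances AM-GM: \<open>D\<close> copies
      of \<open>s\<close> and a sum of inverse squares of order \<open>D^2\<close>, divided by
      \<open>s\<close>, both have order \<open>D * sqrt D\<close>.\<close>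
    have "(1/\<theta> - s)\<^sup>2 = 1 / \<theta>\<^sup>2 - 2 * (s * (1 / \<theta>)) + s * s"
      by (simp add: power2_eq_square algebra_simps)
    then have "2 * (s * (1 / \<theta>)) \<le> s * s + 1 / \<theta>\<^sup>2"
      using zero_le_power2[of "1/\<theta> - s"] by linarith
    moreover have "0 \<le> s * (1 / \<theta>)" using \<theta> s by (simp add: s_def)
    ultimately have "s * (1 / \<theta>) \<le> s * s + 1 / \<theta>\<^sup>2" by linarith
    also have "1 / \<theta>\<^sup>2 \<le> 1 / (c / (4 * D) * real_of_int (\<bar>i h\<bar> + 1))\<^sup>2"
      using i(2)[rule_format, OF h] \<theta> c D by (intro divide_left_mono power_mono zero_less_power mult_pos_pos) (auto simp: \<theta>_def)
    also have "\<dots> = s * (16 * (D * s) / c\<^sup>2 * (1 / (real_of_int (\<bar>i h\<bar> + 1))\<^sup>2))"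
    proof -
      have "real D * real D = s * (D * s)" using s(2) by (simp add: s_def)
      then show ?thesis using s c by (simp add: power_mult_distrib power_divide power2_eq_square mult_ac)
    qed
    finally have "s * (1 / \<theta>) \<le> s * (s + 16 * (D * s) / c\<^sup>2 * (1 / (real_of_int (\<bar>i h\<bar> + 1))\<^sup>2))"
      by (simp add: distrib_left)
    then show "1 / dist_int (h * \<alpha>) \<le> sqrt D + 16 * (D * sqrt D) / c\<^sup>2 * (1 / (real_of_int (\<bar>i h\<bar> + 1))\<^sup>2)"
      using s(1) unfolding s_def \<theta>_def by (rule mult_left_le_imp_le)
  qed
  also have "\<dots> = D * sqrt D + 16 * (D * sqrt D) / c\<^sup>2 * (\<Sum>h\<in>{D..<2*D}. 1 / (real_of_int (\<bar>i h\<bar> + 1))\<^sup>2)"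
    unfolding sum.distrib sum_distrib_left[symmetric] by simp
  also have "(\<Sum>h\<in>{D..<2*D}. 1 / (real_of_int (\<bar>i h\<bar> + 1))\<^sup>2) = (\<Sum>z\<in>i ` {D..<2*D}. 1 / (real_of_int (\<bar>z\<bar> + 1))\<^sup>2)"
    using i(1) by (simp add: sum.reindex)
  also have "D * sqrt D + 16 * (D * sqrt D) / c\<^sup>2 * (\<Sum>z\<in>i ` {D..<2*D}. 1 / (real_of_int (\<bar>z\<bar> + 1))\<^sup>2)
     \<le> D * sqrt D + 16 * (D * sqrt D) / c\<^sup>2 * 4"
    by (intro add_left_mono mult_left_mono sum_inverse_squares_int_le) auto
  finally show ?thesis by (simp add: algebra_simps)
qed

text \<open>There is no additive constant: a nonempty set forces \<open>1 < z\<close>, and the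
  integers with \<open>\<bar>a\<bar> + 1 < z\<close> number at most \<open>2 * z\<close>. An extra 1
  would cost \<open>M / sqrt D\<close> in every block and ruin the small ones.\<close>

lemma card_dist_int_less:
  "real (card {h\<in>{D..<2*D}. dist_int (h * \<alpha>) < y}) \<le> 8 * D * y / c" if "0 \<le> y" for y :: real
proof -
  obtain i where i: "inj_on i {D..<2*D}"
    "\<forall>h\<in>{D..<2*D}. c / (4 * D) * real_of_int (\<bar>i h\<bar> + 1) \<le> dist_int (h * \<alpha>)"
    by (rule dyadic_index)
  define z where "z = 4 * D * y / c"
  let ?B = "{h\<in>{D..<2*D}. dist_int (h * \<alpha>) < y}"
  have le: "real_of_int \<bar>i h\<bar> + 1 < z" if "h \<in> ?B" for h
  proof -
    have "c / (4 * D) * real_of_int (\<bar>i h\<bar> + 1) < y" using that i(2)[rule_format, of h] by auto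
    then show ?thesis using c D by (simp add: z_def field_simps)
  qed
  show ?thesis
  proof (cases "?B = {}")
    case True
    then show ?thesis using c that by (simp only: card.empty) simp
  next
    case False
    then have z1: "1 < z" using le by (smt (verit) all_not_in_conv of_int_0_le_iff abs_ge_zero)
    have "i ` ?B \<subseteq> {- (\<lceil>z\<rceil> - 2)..\<lceil>z\<rceil> - 2}"
    proof
      fix a assume "a \<in> i ` ?B"
      then have "real_of_int \<bar>a\<bar> + 1 < z" using le by auto
      then show "a \<in> {- (\<lceil>z\<rceil> - 2)..\<lceil>z\<rceil> - 2}" by (auto simp: abs_if split: if_splits) linarith+
    qed
    then have "card (i ` ?B) \<le> card {- (\<lceil>z\<rceil> - 2)..\<lceil>z\<rceil> - 2}" by (intro card_mono) auto
    moreover have "card (i ` ?B) = card ?B" by (intro card_image inj_on_subset[OF i(1)]) auto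
    ultimately have "real (card ?B) \<le> 2 * real_of_int \<lceil>z\<rceil> - 3" using z1 by (simp add: le_nat_iff) linarith
    also have "\<dots> \<le> 2 * z" by linarith
    finally show ?thesis by (simp add: z_def)
  qed
qed

end

subsection \<open>Summation over frequencies\<close>

text \<open>The near frequencies number at most \<open>32 * D^2 * B / (c * M)\<close>, so the factor
  \<open>M\<close> in their bound cancels and they cost order \<open>B * sqrt D\<close> after
  division by \<open>D\<close>. The far ones are summed through \<open>1 / dist_int\<close> and cost
  order \<open>sqrt D\<close>.\<close>

lemma sum_dyadic_block_le:
  fixes \<alpha> c A B M :: real and D :: nat and T :: "nat \<Rightarrow> real"
  assumes c: "0 < c" and D: "0 < D"
    and bad: "\<And>h m. 0 < h \<Longrightarrow> h < 2 * D \<Longrightarrow> c / real h \<le> \<bar>real h * \<alpha> - of_int m\<bar>"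
    and A: "0 \<le> A" and B: "0 \<le> B" and M: "0 < M"
    and T_far: "\<And>h. D \<le> h \<Longrightarrow> h < 2 * D \<Longrightarrow> 2 * real h * B / M \<le> dist_int (h * \<alpha>) \<Longrightarrow> T h \<le> A / dist_int (h * \<alpha>)"
    and T_near: "\<And>h. D \<le> h \<Longrightarrow> h < 2 * D \<Longrightarrow> dist_int (h * \<alpha>) < 2 * real h * B / M \<Longrightarrow> T h \<le> A * M / sqrt h"
    and T: "\<And>h. 0 \<le> T h"
  shows "(\<Sum>h=D..<2*D. T h / h) \<le> A * (1 + 64 / c\<^sup>2 + 32 * B / c) * sqrt D"
proof -
  define G where "G = {h\<in>{D..<2*D}. 2 * real h * B / M \<le> dist_int (h * \<alpha>)}"
  define N where "N = {D..<2*D} - G"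
  have s: "0 < sqrt D" "sqrt D * sqrt D = D" using D by auto
  have cancel: "a * (x * x) / x = a * x" for a x :: real by simp
  have "(\<Sum>h\<in>G. T h) \<le> (\<Sum>h\<in>G. A * (1 / dist_int (h * \<alpha>)))"
    by (intro sum_mono) (use T_far in \<open>auto simp: G_def\<close>)
  also have "\<dots> \<le> A * ((1 + 64 / c\<^sup>2) * (D * sqrt D))"
    unfolding sum_distrib_left[symmetric] using A
    by (intro mult_left_mono sum_inverse_dist_int_le[OF c D bad]) (auto simp: G_def)
  finally have 1: "(\<Sum>h\<in>G. T h) \<le> A * ((1 + 64 / c\<^sup>2) * (D * sqrt D))" .
  have "(\<Sum>h\<in>N. T h) \<le> (\<Sum>h\<in>N. A * M / sqrt D)"
  proof (intro sum_mono)
    fix h assume h: "h \<in> N"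
    then have "T h \<le> A * M / sqrt h" by (intro T_near) (auto simp: N_def G_def)
    also have "\<dots> \<le> A * M / sqrt D" using h A M D by (intro divide_left_mono) (auto simp: N_def)
    finally show "T h \<le> A * M / sqrt D" .
  qed
  also have "\<dots> = real (card N) * (A * M / sqrt D)" by simp
  also have "\<dots> \<le> (8 * D * (4 * D * B / M) / c) * (A * M / sqrt D)"
  proof (rule mult_right_mono)
    have "2 * real h * B / M \<le> 4 * D * B / M" if "h < 2 * D" for h
      using that B M by (intro divide_right_mono mult_right_mono) auto
    then have "N \<subseteq> {h\<in>{D..<2*D}. dist_int (h * \<alpha>) < 4 * D * B / M}"
      by (force simp: N_def G_def)
    then have "real (card N) \<le> real (card {h\<in>{D..<2*D}. dist_int (h * \<alpha>) < 4 * D * B / M})"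
      by (intro of_nat_mono card_mono) auto
    also have "\<dots> \<le> 8 * D * (4 * D * B / M) / c"
      using B M by (intro card_dist_int_less[OF c D bad]) auto
    finally show "real (card N) \<le> 8 * D * (4 * D * B / M) / c" .
  qed (use A M in auto)
  also have "\<dots> = A * (32 * B / c) * (D * (sqrt D * sqrt D) / sqrt D)" using M s(2) by simp
  also have "D * (sqrt D * sqrt D) / sqrt D = D * sqrt D" by (rule cancel)
  finally have 2: "(\<Sum>h\<in>N. T h) \<le> A * (32 * B / c) * (D * sqrt D)" .
  have "(\<Sum>h=D..<2*D. T h / h) \<le> (\<Sum>h=D..<2*D. T h / D)"
    using T D by (intro sum_mono divide_left_mono) auto
  also have "\<dots> = ((\<Sum>h\<in>N. T h) + (\<Sum>h\<in>G. T h)) / D"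
    unfolding N_def sum_divide_distrib[symmetric] by (subst sum.subset_diff[of G]) (auto simp: G_def)
  also have "\<dots> \<le> (A * (1 + 64 / c\<^sup>2 + 32 * B / c) * (D * sqrt D)) / D"
    using 1 2 by (intro divide_right_mono) (auto simp: algebra_simps)
  finally show ?thesis using D by simp
qed

text \<open>The constant 3 survives the induction because
  \<open>3 + 1 \<le> 3 * sqrt 2\<close>.\<close>

lemma sum_dyadic_le:
  fixes T :: "nat \<Rightarrow> real"
  assumes "\<And>i. i < K \<Longrightarrow> (\<Sum>h=2^i..<2*2^i. T h / h) \<le> C * sqrt (2 ^ i)" and C: "0 \<le> C"
  shows "(\<Sum>h=1..<2^K. T h / h) \<le> 3 * C * sqrt (2 ^ K)"
  using assms(1)
proof (induction K)
  case (Suc K)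
  have "(\<Sum>h=1..<2^Suc K. T h / h) = (\<Sum>h=1..<2^K. T h / h) + (\<Sum>h=2^K..<2*2^K. T h / h)"
    by (simp add: sum.atLeastLessThan_concat)
  also have "\<dots> \<le> 3 * C * sqrt (2 ^ K) + C * sqrt (2 ^ K)"
    by (intro add_mono Suc) auto
  also have "\<dots> = (C * sqrt (2 ^ K)) * 4" by simp
  also have "\<dots> \<le> (C * sqrt (2 ^ K)) * (3 * sqrt 2)"
  proof (intro mult_left_mono)
    have "(4/3)\<^sup>2 \<le> (2::real)" by (simp add: power2_eq_square)
    then have "4/3 \<le> sqrt 2" by (rule real_le_rsqrt)
    then show "4 \<le> 3 * sqrt 2" by simp
  qed (use C in auto)
  finally show ?case by (simp add: real_sqrt_mult mult_ac)
qed (use C in simp)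

text \<open>The slope of \<open>\<gamma>\<close> moves the increments \<open>h \<beta>\<close> by at
  most half their distance to the nearest integer, so the other half remains for Kuzmin-Landau. At
  the opposite integer this uses that the distance is at most \<open>1/2\<close>; \<open>m'\<close>
  is the integer below \<open>h \<beta>\<close>.\<close>

lemma weyl_sum_nearly_linear:
  fixes \<gamma> :: "nat \<Rightarrow> real" and \<beta> B M :: real and m :: int and n h :: nat
  assumes h: "0 < h" and M: "0 < M"
    and convex: "\<And>j. 1 \<le> j \<Longrightarrow> Suc j < n \<Longrightarrow> \<gamma> (Suc j) - \<gamma> j \<le> \<gamma> (Suc (Suc j)) - \<gamma> (Suc j)"
    and lip: "\<And>j. 1 \<le> j \<Longrightarrow> j < n \<Longrightarrow> \<bar>\<gamma> (Suc j) - \<gamma> j\<bar> \<le> B / M"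
    and \<theta>: "0 < \<bar>h * \<beta> - m\<bar>" "\<bar>h * \<beta> - m\<bar> \<le> 1/2" "2 * real h * B / M \<le> \<bar>h * \<beta> - m\<bar>"
  shows "weyl_sum (\<lambda>j. \<gamma> j + j * \<beta>) {1..<n} h \<le> 6 / \<bar>h * \<beta> - m\<bar>"
proof -
  define \<theta> where "\<theta> = \<bar>h * \<beta> - m\<bar>"
  define y where "y j = h * (\<gamma> j + j * \<beta>)" for j
  define m' where "m' = (if h * \<beta> - m > 0 then m else m - 1)"
  have d: "y (Suc j) - y j = h * (\<gamma> (Suc j) - \<gamma> j) + h * \<beta>" for j
    by (simp add: y_def algebra_simps)
  have "norm (\<Sum>j=1..<n. cis (2 * pi * y j)) \<le> 3 / (\<theta> / 2)"
  proof (rule kuzmin_landau[where m = m'])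
    show "y (Suc j) - y j \<le> y (Suc (Suc j)) - y (Suc j)" if "1 \<le> j" "Suc j < n" for j
      unfolding d using convex[OF that] by (intro add_right_mono mult_left_mono) auto
    show "0 < \<theta> / 2" using \<theta> by (simp add: \<theta>_def)
    show "of_int m' + \<theta> / 2 \<le> y (Suc j) - y j \<and> y (Suc j) - y j \<le> of_int m' + 1 - \<theta> / 2" if "1 \<le> j" "j < n" for j
    proof -
      have "\<bar>h * (\<gamma> (Suc j) - \<gamma> j)\<bar> \<le> h * (B / M)"
        unfolding abs_mult using lip[OF that] by (intro mult_mono) auto
      also have "h * (B / M) = (2 * real h * B / M) / 2" by simp
      also have "\<dots> \<le> \<theta> / 2" using \<theta>(3) unfolding \<theta>_def by (rule divide_right_mono) simp
      finally have "\<bar>h * (\<gamma> (Suc j) - \<gamma> j)\<bar> \<le> \<theta> / 2" .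
      moreover have "\<theta> \<le> 1/2" using \<theta> by (simp add: \<theta>_def)
      moreover have "h * \<beta> = m + \<theta> \<and> m' = m \<or> h * \<beta> = m - \<theta> \<and> m' = m - 1"
        by (auto simp: \<theta>_def m'_def)
      ultimately show ?thesis unfolding d by (elim disjE conjE) (simp only: of_int_diff of_int_1, linarith)+
    qed
  qed
  then show ?thesis by (simp add: weyl_sum_def y_def \<theta>_def)
qed

text \<open>The increments stay within \<open>1/2 + 1/4\<close> of \<open>m\<close>, from the
  distance of \<open>h \<beta>\<close> and from the slope respectively, and grow by at least
  \<open>h * \<kappa> / M^2\<close> at each step.\<close>

lemma weyl_sum_curved:
  fixes \<gamma> :: "nat \<Rightarrow> real" and \<beta> B M \<kappa> :: real and m :: int and n h :: nat
  assumes h: "0 < h" and M: "0 < M" and \<kappa>: "0 < \<kappa>"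
    and convex: "\<And>j. 1 \<le> j \<Longrightarrow> Suc j < n \<Longrightarrow> \<gamma> (Suc j) - \<gamma> j + \<kappa> / M\<^sup>2 \<le> \<gamma> (Suc (Suc j)) - \<gamma> (Suc j)"
    and lip: "\<And>j. 1 \<le> j \<Longrightarrow> j < n \<Longrightarrow> \<bar>\<gamma> (Suc j) - \<gamma> j\<bar> \<le> B / M"
    and \<theta>: "\<bar>h * \<beta> - m\<bar> \<le> 1/2"
    and small: "h * B / M \<le> 1/4" "h * \<kappa> / M\<^sup>2 \<le> 1/16"
  shows "weyl_sum (\<lambda>j. \<gamma> j + j * \<beta>) {1..<n} h \<le> 9 / sqrt \<kappa> * M / sqrt h"
proof -
  define y where "y j = h * (\<gamma> j + j * \<beta>)" for j
  have d: "y (Suc j) - y j = h * (\<gamma> (Suc j) - \<gamma> j) + h * \<beta>" for j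
    by (simp add: y_def algebra_simps)
  have "norm (\<Sum>j=1..<n. cis (2 * pi * y j)) \<le> 9 / sqrt (h * \<kappa> / M\<^sup>2)"
  proof (rule van_der_corput[where m = m])
    show "y (Suc j) - y j + h * \<kappa> / M\<^sup>2 \<le> y (Suc (Suc j)) - y (Suc j)" if "1 \<le> j" "Suc j < n" for j
      using mult_left_mono[OF convex[OF that], of "real h"] unfolding d by (simp add: algebra_simps)
    show "0 < h * \<kappa> / M\<^sup>2" "h * \<kappa> / M\<^sup>2 \<le> 1/16" using h \<kappa> M small by auto
    show "\<bar>y (Suc j) - y j - m\<bar> \<le> 3/4" if "1 \<le> j" "j < n" for j
    proof -
      have "\<bar>h * (\<gamma> (Suc j) - \<gamma> j)\<bar> \<le> h * (B / M)"
        unfolding abs_mult using lip[OF that] by (intro mult_mono) auto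
      then show ?thesis unfolding d using \<theta> small(1) by (simp only: times_divide_eq_right)
    qed
  qed
  also have "\<dots> = 9 / sqrt \<kappa> * M / sqrt h" using M by (simp add: real_sqrt_divide real_sqrt_mult)
  finally show ?thesis by (simp add: weyl_sum_def y_def)
qed

lemma weyl_sum_uminus: "weyl_sum (\<lambda>j. - x j) J h = weyl_sum x J h"
proof -
  have "(\<Sum>j\<in>J. cis (2 * pi * (real h * - x j))) = cnj (\<Sum>j\<in>J. cis (2 * pi * (real h * x j)))"
    by (simp add: cis_cnj)
  then show ?thesis unfolding weyl_sum_def by (simp only: complex_mod_cnj)
qed

lemma dist_int_uminus: "\<bar>h * - \<alpha> - of_int (- round (h * \<alpha>))\<bar> = dist_int (h * \<alpha>)"
  by (simp add: dist_int_def)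

lemma dist_int_le: "dist_int x \<le> 1/2"
  unfolding dist_int_def using of_int_round_abs_le[of x] by linarith

lemma power_of_two_bracket:
  fixes x :: real
  assumes "1 \<le> x"
  obtains K where "2 ^ K \<le> x" "x < 2 * 2 ^ K"
proof -
  obtain N where N: "x < 2 ^ N" using real_arch_pow[of 2 x] by auto
  define P where "P n \<longleftrightarrow> x < 2 ^ n" for n :: nat
  define L where "L = (LEAST n. P n)"
  have "P L" unfolding L_def by (rule LeastI[of P N]) (simp add: P_def N)
  moreover from this have "L \<noteq> 0" using assms by (intro notI) (simp add: P_def)
  then have "\<not> P (L - 1)" using not_less_Least[of "L - 1" P] by (simp add: L_def[symmetric])
  ultimately show ?thesis
    using \<open>L \<noteq> 0\<close> by (intro that[of "L - 1"]) (auto simp: P_def simp flip: power_Suc)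
qed

text \<open>Here \<open>q\<close> is the cube root of \<open>M\<close>, and the cut-off is a power
  of two between \<open>q^2 / 2\<close> and \<open>q^2\<close>, so dyadic blocks exhaust the
  frequencies and both error terms are of order \<open>q\<close>. The bound \<open>2 \<le> q\<close>
  ensures \<open>2 h \<le> M\<close>, as bad approximability requires. With \<open>c = 1/8\<close>
  the block constant becomes \<open>1 + 64 * 64 = 4097\<close> and
  \<open>32 * 8 = 256\<close>.\<close>

lemma saw_sum_fib_le:
  fixes x :: "nat \<Rightarrow> real" and \<alpha> q A B :: real
  assumes \<alpha>: "\<alpha> = real (fib (k - 1)) / real (fib k)"
    and k: "1 \<le> k" and n: "n \<le> fib k" and q: "q ^ 3 = real (fib k)" "2 \<le> q" and A: "0 \<le> A" and B: "0 \<le> B"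
    and far: "\<And>h. 0 < h \<Longrightarrow> real h \<le> q\<^sup>2 \<Longrightarrow> 0 < dist_int (h * \<alpha>) \<Longrightarrow> 2 * real h * B / q ^ 3 \<le> dist_int (h * \<alpha>)
       \<Longrightarrow> weyl_sum x {1..<n} h \<le> A / dist_int (h * \<alpha>)"
    and near: "\<And>h. 0 < h \<Longrightarrow> real h \<le> q\<^sup>2 \<Longrightarrow> dist_int (h * \<alpha>) < 2 * real h * B / q ^ 3
       \<Longrightarrow> weyl_sum x {1..<n} h \<le> A * q ^ 3 / sqrt h"
  shows "\<bar>\<Sum>j=1..<n. saw (x j)\<bar> \<le> (80 + 12 * A * (4097 + 256 * B)) * q"
proof -
  have "1 \<le> q\<^sup>2" using q by (simp add: one_le_power)
  then obtain K where K: "2 ^ K \<le> q\<^sup>2" "q\<^sup>2 < 2 * 2 ^ K" by (rule power_of_two_bracket)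
  have q3: "2 * q\<^sup>2 \<le> q ^ 3" using q(2) by (simp add: power2_eq_square power3_eq_cube)
  define C where "C = A * (4097 + 256 * B)"
  have C: "0 \<le> C" using A B by (simp add: C_def)
  have "(\<Sum>h=1..<2^K. weyl_sum x {1..<n} h / h) \<le> 3 * C * sqrt (2 ^ K)"
  proof (rule sum_dyadic_le[OF _ C])
    fix i assume i: "i < K"
    have "(2::nat) * 2 ^ i \<le> 2 ^ K" using i by (metis Suc_leI one_le_numeral power_Suc power_increasing)
    then have "real (2 * 2 ^ i) \<le> real (2 ^ K)" by (rule of_nat_mono)
    then have h_le: "real h \<le> q\<^sup>2" if "h < 2 * 2 ^ i" for h :: nat
    proof -
      have "real h \<le> real ((2::nat) ^ K)" using that \<open>2 * 2 ^ i \<le> 2 ^ K\<close> by (intro of_nat_mono) linarith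
      also have "\<dots> = 2 ^ K" by simp
      finally have "real h \<le> 2 ^ K" .
      from order_trans[OF this K(1)] show ?thesis .
    qed
    have bad: "(1/8) / real h \<le> \<bar>real h * \<alpha> - of_int m\<bar>" if "0 < h" "h < 2 * 2 ^ i" for h :: nat and m :: int
    proof -
      have "real (2 * h) \<le> real (fib k)" using h_le[OF that(2)] q3 q by simp
      then have "2 * h \<le> fib k" by (simp only: of_nat_le_iff)
      then show ?thesis using fib_ratio_badly_approximable[OF k that(1), of m] by (simp add: \<alpha>)
    qed
    have pos: "0 < dist_int (h * \<alpha>)" if "2 ^ i \<le> h" "h < 2 * 2 ^ i" for h :: nat
      using that by (intro dist_int_pos[of "1/8" "2^i", OF _ _ bad]) auto
    have "(\<Sum>h=2^i..<2*2^i. weyl_sum x {1..<n} h / h) \<le> A * (1 + 64 / (1/8)\<^sup>2 + 32 * B / (1/8)) * sqrt (real (2 ^ i))"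
    proof (rule sum_dyadic_block_le[where M = "q ^ 3", OF _ _ bad A B])
      fix h :: nat assume h: "2 ^ i \<le> h" "h < 2 * 2 ^ i"
      have h0: "0 < h" using h(1) by (metis less_le_trans pos2 zero_less_power)
      show "weyl_sum x {1..<n} h \<le> A / dist_int (h * \<alpha>)" if "2 * real h * B / q ^ 3 \<le> dist_int (h * \<alpha>)"
        using far[OF h0 h_le[OF h(2)] pos[OF h] that] .
      show "weyl_sum x {1..<n} h \<le> A * q ^ 3 / sqrt h" if "dist_int (h * \<alpha>) < 2 * real h * B / q ^ 3"
        using near[OF h0 h_le[OF h(2)] that] .
    qed (use q k fib_neq_0_nat[of k] in \<open>auto simp: weyl_sum_def\<close>)
    then show "(\<Sum>h=2^i..<2*2^i. weyl_sum x {1..<n} h / h) \<le> C * sqrt (2 ^ i)"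
      by (simp add: C_def power2_eq_square mult_ac)
  qed
  also have "sqrt (2 ^ K) \<le> q" using K(1) q by (intro real_le_lsqrt) auto
  finally have 1: "(\<Sum>h=1..<2^K. weyl_sum x {1..<n} h / h) \<le> 3 * C * q"
    using C by (simp add: mult_left_mono)
  have "real (card {1..<n}) \<le> q ^ 3" using n q by simp
  also have "q ^ 3 = q\<^sup>2 * q" by (simp add: power2_eq_square power3_eq_cube)
  also have "\<dots> \<le> (2 * 2 ^ K) * q" using K(2) q by (intro mult_right_mono) auto
  finally have 2: "40 * real (card {1..<n}) / 2 ^ K \<le> 80 * q"
    by (simp add: divide_le_eq mult_ac)
  have "\<bar>\<Sum>j=1..<n. saw (x j)\<bar> \<le> 40 * real (card {1..<n}) / real (2 ^ K) + 4 * (\<Sum>h=1..<2^K. weyl_sum x {1..<n} h / h)"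
    by (rule erdos_turan_saw) auto
  also have "\<dots> \<le> 80 * q + 4 * (3 * C * q)" using 1 2 by (intro add_mono mult_left_mono) auto
  finally show ?thesis by (simp add: C_def algebra_simps)
qed

section \<open>Sequences sampled from a function with curvature bounded below\<close>

lemma mvt_within:
  fixes f f' :: "real \<Rightarrow> real"
  assumes "\<And>x. x \<in> {a..b} \<Longrightarrow> (f has_real_derivative f' x) (at x within {a..b})" "a < b"
  obtains z where "a < z" "z < b" "f b - f a = (b - a) * f' z"
proof -
  have "\<exists>z\<in>{a<..<b}. f b - f a = (*) (f' z) (b - a)"
    using assms(1) by (intro mvt_simple assms(2)) (simp add: has_field_derivative_def)
  then show ?thesis using that by (auto simp: mult.commute)
qed

text \<open>The later error bounds depend on \<open>g\<close> only through \<open>B\<close> and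
  \<open>\<kappa>\<close>, which makes them uniform in \<open>k\<close>.\<close>

locale curved_function =
  fixes g g' g'' :: "real \<Rightarrow> real" and B \<kappa> :: real
  assumes g: "\<And>x. x \<in> {0..1} \<Longrightarrow> (g has_real_derivative g' x) (at x within {0..1})"
    and g': "\<And>x. x \<in> {0..1} \<Longrightarrow> (g' has_real_derivative g'' x) (at x within {0..1})"
    and B: "\<And>x. x \<in> {0..1} \<Longrightarrow> \<bar>g' x\<bar> \<le> B"
    and \<kappa>: "0 < \<kappa>" "\<And>x. x \<in> {0..1} \<Longrightarrow> \<kappa> \<le> g'' x"
begin

lemma B_nonneg: "0 \<le> B" using B[of 0] by simp

lemma lipschitz:
  assumes "0 \<le> a" "a \<le> b" "b \<le> 1"
  shows "\<bar>g b - g a\<bar> \<le> B * (b - a)"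
proof (cases "a = b")
  case False
  then have "a < b" using assms by simp
  have "(g has_real_derivative g' x) (at x within {a..b})" if "x \<in> {a..b}" for x
    using that assms by (intro DERIV_subset[OF g]) auto
  then obtain z where "a < z" "z < b" "g b - g a = (b - a) * g' z"
    using mvt_within[OF _ \<open>a < b\<close>] by metis
  then show ?thesis using B[of z] assms by (auto simp: abs_mult mult.commute intro!: mult_right_mono)
qed simp

text \<open>The mean value theorem is applied to the first difference \<open>F\<close> and then to
  \<open>g'\<close>, turning the pointwise bound into discrete convexity.\<close>

lemma second_difference_ge:
  assumes "0 \<le> a" "0 < t" "a + 2 * t \<le> 1"
  shows "g (a + t) - g a + \<kappa> * t\<^sup>2 \<le> g (a + 2 * t) - g (a + t)"
proof -
  define F where "F u = g (u + t) - g u" for u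
  have 1: "(F has_real_derivative g' (u + t) - g' u) (at u within {a..a+t})" if "u \<in> {a..a+t}" for u
  proof -
    have "(g has_real_derivative g' (u + t)) (at (u + t) within (\<lambda>u. u + t) ` {a..a+t})"
      using that assms by (intro DERIV_subset[OF g]) auto
    then have "(g \<circ> (\<lambda>u. u + t) has_real_derivative g' (u + t) * 1) (at u within {a..a+t})"
      by (rule DERIV_image_chain) (auto intro!: derivative_eq_intros)
    moreover have "(g has_real_derivative g' u) (at u within {a..a+t})"
      using that assms by (intro DERIV_subset[OF g]) auto
    ultimately show ?thesis unfolding F_def by (auto intro!: derivative_eq_intros simp: o_def)
  qed
  obtain z where z: "a < z" "z < a + t" "F (a + t) - F a = (a + t - a) * (g' (z + t) - g' z)"
    using mvt_within[OF 1] assms by auto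
  have 2: "(g' has_real_derivative g'' u) (at u within {z..z+t})" if "u \<in> {z..z+t}" for u
    using that z assms by (intro DERIV_subset[OF g']) auto
  obtain w where w: "z < w" "w < z + t" "g' (z + t) - g' z = (z + t - z) * g'' w"
    using mvt_within[OF 2] assms by auto
  have "\<kappa> * t\<^sup>2 \<le> g'' w * t\<^sup>2" using \<kappa>(2)[of w] w z assms by (intro mult_right_mono) auto
  also have "\<dots> = F (a + t) - F a" using z(3) w(3) by (simp add: power2_eq_square)
  finally show ?thesis by (simp add: F_def add.assoc flip: mult_2)
qed

text \<open>The sign \<open>\<sigma>\<close> reduces concave functions to convex ones: the sequence is \<open>\<sigma> g(j / M) - j \<alpha>\<close>.\<close>

lemma saw_sum_curve_le:
  fixes q :: real and \<sigma> :: int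
  assumes k: "1 \<le> k" and n: "n \<le> fib k" and q: "q ^ 3 = real (fib k)" "2 \<le> q" "4 * B \<le> q" "2 * \<kappa> \<le> q"
    and \<sigma>: "\<sigma> = 1 \<or> \<sigma> = -1"
  shows "\<bar>\<Sum>j=1..<n. saw (\<sigma> * (g (real j / fib k) + real j * (- \<sigma> * (fib (k - 1) / fib k))))\<bar>
     \<le> (80 + 12 * (6 + 9 / sqrt \<kappa>) * (4097 + 256 * B)) * q"
proof (rule saw_sum_fib_le[OF refl k n q(1,2) _ B_nonneg])
  define M where "M = real (fib k)"
  define \<alpha> where "\<alpha> = fib (k - 1) / M"
  define \<gamma> where "\<gamma> j = g (real j / M)" for j :: nat
  have M: "0 < M" "M = q ^ 3" using q by (auto simp: M_def simp flip: q(1))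
  \<comment> \<open>Pulling \<open>\<sigma>\<close> out of the whole sequence at most conjugates the
    exponential sum. The linear term inside then has slope \<open>- \<sigma> \<alpha>\<close>, as
    \<open>\<sigma>\<close> squares to 1.\<close>
  have weyl: "weyl_sum (\<lambda>j. \<sigma> * (g (real j / fib k) + real j * (- \<sigma> * (fib (k - 1) / fib k)))) {1..<n} h = weyl_sum (\<lambda>j. \<gamma> j + real j * (- \<sigma> * \<alpha>)) {1..<n} h" for h
  proof -
    have "weyl_sum (\<lambda>j. real_of_int \<sigma> * y j) J h = weyl_sum y J h" for y J
      using \<sigma> weyl_sum_uminus[of y J h] by auto
    then show ?thesis by (simp only: \<gamma>_def \<alpha>_def M_def)
  qed
  have \<theta>: "\<bar>h * (- \<sigma> * \<alpha>) - of_int (- \<sigma> * round (h * \<alpha>))\<bar> = dist_int (h * \<alpha>)" for h :: nat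
    using \<sigma> dist_int_uminus[of h \<alpha>] by (auto simp: dist_int_def)
  have lip: "\<bar>\<gamma> (Suc j) - \<gamma> j\<bar> \<le> B / M" if "1 \<le> j" "j < n" for j
  proof -
    have "real (Suc j) \<le> M" using that n unfolding M_def by linarith
    then have "\<bar>\<gamma> (Suc j) - \<gamma> j\<bar> \<le> B * (real (Suc j) / M - real j / M)"
      unfolding \<gamma>_def using M by (intro lipschitz divide_right_mono) auto
    then show ?thesis by (simp add: diff_divide_distrib[symmetric])
  qed
  have conv: "\<gamma> (Suc j) - \<gamma> j + \<kappa> / M\<^sup>2 \<le> \<gamma> (Suc (Suc j)) - \<gamma> (Suc j)" if "1 \<le> j" "Suc j < n" for j
  proof -
    have "real (Suc (Suc j)) \<le> M" using that n unfolding M_def by linarith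
    then have "j / M + 2 * (1 / M) \<le> 1" using M by (simp add: field_simps)
    then have "g (j / M + 1 / M) - g (j / M) + \<kappa> * (1 / M)\<^sup>2 \<le> g (j / M + 2 * (1 / M)) - g (j / M + 1 / M)"
      using M by (intro second_difference_ge) auto
    moreover have "j / M + 1 / M = Suc j / M" "j / M + 2 * (1 / M) = Suc (Suc j) / M"
      by (simp_all add: add_divide_distrib)
    ultimately show ?thesis by (simp add: \<gamma>_def power_divide)
  qed
  have A: "0 \<le> 9 / sqrt \<kappa>" using \<kappa>(1) by simp
  then show "0 \<le> 6 + 9 / sqrt \<kappa>" by simp
  fix h :: nat
  assume h: "0 < h" "real h \<le> q\<^sup>2"
  { assume "0 < dist_int (h * (fib (k - 1) / fib k))" "2 * real h * B / q ^ 3 \<le> dist_int (h * (fib (k - 1) / fib k))"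
    then have *: "0 < dist_int (h * \<alpha>)" "2 * real h * B / M \<le> dist_int (h * \<alpha>)" by (simp_all add: \<alpha>_def M)  (simp_all add: q(1))
    have "weyl_sum (\<lambda>j. \<gamma> j + real j * (- \<sigma> * \<alpha>)) {1..<n} h \<le> 6 / \<bar>h * (- \<sigma> * \<alpha>) - of_int (- \<sigma> * round (h * \<alpha>))\<bar>"
    proof (rule weyl_sum_nearly_linear[where M = M and B = B and \<beta> = "- \<sigma> * \<alpha>" and m = "- \<sigma> * round (h * \<alpha>)" and \<gamma> = \<gamma>])
      show "\<gamma> (Suc j) - \<gamma> j \<le> \<gamma> (Suc (Suc j)) - \<gamma> (Suc j)" if "1 \<le> j" "Suc j < n" for j
      proof -
        have "0 \<le> \<kappa> / M\<^sup>2" using \<kappa>(1) by simp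
        then show ?thesis using conv[OF that] by linarith
      qed
    qed (use * dist_int_le h(1) M(1) lip in \<open>simp_all only: \<theta>\<close>)
    also have "\<dots> \<le> (6 + 9 / sqrt \<kappa>) / dist_int (h * \<alpha>)"
      unfolding \<theta> using * A by (intro divide_right_mono) auto
    finally show "weyl_sum (\<lambda>j. \<sigma> * (g (real j / fib k) + real j * (- \<sigma> * (fib (k - 1) / fib k)))) {1..<n} h
      \<le> (6 + 9 / sqrt \<kappa>) / dist_int (h * (fib (k - 1) / fib k))"
      unfolding weyl by (simp add: \<alpha>_def M_def) }
  { assume "dist_int (h * (fib (k - 1) / fib k)) < 2 * real h * B / q ^ 3"
    \<comment> \<open>With \<open>h \<le> q^2\<close> and \<open>M = q^3\<close>, the assumption
      \<open>4 * B \<le> q\<close> bounds the slope by \<open>1/4\<close>, and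
      \<open>2 * \<kappa> \<le> q\<close> with \<open>2 \<le> q\<close> bounds the curvature by
      \<open>1/16\<close>.\<close>
    have "h * B / M \<le> q\<^sup>2 * B / M" using h M B_nonneg by (intro divide_right_mono mult_right_mono) auto
    also have "\<dots> = B / q" using q(2) by (simp add: M(2) power2_eq_square power3_eq_cube)
    also have "\<dots> \<le> 1/4" using q by (simp add: divide_le_eq)
    finally have small1: "h * B / M \<le> 1/4" .
    have "h * \<kappa> / M\<^sup>2 \<le> q\<^sup>2 * \<kappa> / M\<^sup>2" using h M \<kappa>(1) by (intro divide_right_mono mult_right_mono) auto
    also have "\<dots> = \<kappa> / q ^ 4" using q(2) by (simp add: M(2) power2_eq_square power3_eq_cube power4_eq_xxxx)
    also have "\<dots> \<le> (q / 2) / q ^ 4" using q by (intro divide_right_mono) auto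
    also have "\<dots> = (1/2) * (1 / q) ^ 3" using q(2) by (simp add: power_divide power3_eq_cube power4_eq_xxxx)
    also have "\<dots> \<le> (1/2) * (1 / 2) ^ 3" using q(2) by (intro mult_left_mono power_mono divide_left_mono) auto
    finally have small2: "h * \<kappa> / M\<^sup>2 \<le> 1/16" by (simp add: power3_eq_cube)
    have "weyl_sum (\<lambda>j. \<gamma> j + real j * (- \<sigma> * \<alpha>)) {1..<n} h \<le> 9 / sqrt \<kappa> * M / sqrt h"
      by (rule weyl_sum_curved[where M = M and B = B and \<beta> = "- \<sigma> * \<alpha>" and m = "- \<sigma> * round (h * \<alpha>)" and \<gamma> = \<gamma>])
        (use h(1) M(1) \<kappa>(1) conv lip small1 small2 dist_int_le in \<open>simp_all only: \<theta>\<close>)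
    also have "\<dots> \<le> (6 + 9 / sqrt \<kappa>) * M / sqrt h"
      using M by (intro divide_right_mono mult_right_mono) auto
    finally show "weyl_sum (\<lambda>j. \<sigma> * (g (real j / fib k) + real j * (- \<sigma> * (fib (k - 1) / fib k)))) {1..<n} h
      \<le> (6 + 9 / sqrt \<kappa>) * q ^ 3 / sqrt h"
      unfolding weyl by (simp add: M) }
qed

end

text \<open>The case of zero slope: with \<open>B = 0\<close> the near regime would need a negative
  distance, so every frequency falls under Kuzmin-Landau.\<close>

lemma saw_sum_linear_le:
  fixes q :: real
  assumes k: "1 \<le> k" and n: "n \<le> fib k" and q: "q ^ 3 = real (fib k)" "2 \<le> q"
  shows "\<bar>\<Sum>j=1..<n. saw (real j * (fib (k - 1) / fib k))\<bar> \<le> (80 + 12 * 6 * (4097 + 256 * 0)) * q"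
proof (rule saw_sum_fib_le[OF refl k n q, where A = 6 and B = 0])
  fix h :: nat
  assume h: "0 < h"
  { assume *: "0 < dist_int (h * (fib (k - 1) / fib k))"
    have "weyl_sum (\<lambda>j. (\<lambda>_. 0) j + real j * (fib (k - 1) / fib k)) {1..<n} h
      \<le> 6 / \<bar>h * (fib (k - 1) / fib k) - of_int (round (h * (fib (k - 1) / fib k)))\<bar>"
      by (rule weyl_sum_nearly_linear[where B = 0 and M = 1])
        (use h * dist_int_le[of "h * (fib (k - 1) / fib k)"] in \<open>simp_all add: dist_int_def\<close>)
    then show "weyl_sum (\<lambda>j. real j * (fib (k - 1) / fib k)) {1..<n} h \<le> 6 / dist_int (h * (fib (k - 1) / fib k))"
      by (simp add: dist_int_def) }
  { assume "dist_int (h * (fib (k - 1) / fib k)) < 2 * real h * (0::real) / q ^ 3"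
    then show "weyl_sum (\<lambda>j. real j * (fib (k - 1) / fib k)) {1..<n} h \<le> 6 * q ^ 3 / sqrt h"
      by (simp add: dist_int_def) }
qed auto

subsection \<open>Counting points below the curve\<close>

text \<open>The value \<open>-1/2\<close> of \<open>saw\<close> at integers makes the identity exact
  also at \<open>frac y = u\<close>. An integer \<open>y\<close> would break it at
  \<open>u = 1\<close>, where the right side equals 2.\<close>

lemma of_bool_frac_le_eq_saw:
  assumes "y \<notin> \<int>" "0 \<le> u" "u \<le> 1"
  shows "of_bool (frac y \<le> u) = u - saw y - saw (u - y)"
proof (cases "frac y \<le> u")
  case True
  have "frac (u - y) = u - frac y"
    unfolding frac_unique_iff using True assms frac_gt_0_iff[of y] by (auto simp: frac_def)
  then show ?thesis using True by (simp add: saw_def)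
next
  case False
  have "frac (u - y) = u - frac y + 1"
    unfolding frac_unique_iff using False assms frac_lt_1[of y] by (auto simp: frac_def)
  then show ?thesis using False by (simp add: saw_def)
qed

lemma fib_ratio_multiple_not_int:
  assumes "1 \<le> k" "0 < j" "j < fib k"
  shows "real j * (real (fib (k - 1)) / real (fib k)) \<notin> \<int>"
proof
  assume "real j * (real (fib (k - 1)) / real (fib k)) \<in> \<int>"
  then obtain m where "real j * (real (fib (k - 1)) / real (fib k)) = of_int m" by (elim Ints_cases)
  then have "real j * real (fib (k - 1)) = of_int m * real (fib k)" using assms by (simp add: field_simps)
  then have "real_of_int (int j * int (fib (k - 1))) = real_of_int (m * int (fib k))" by simp
  then have "int j * int (fib (k - 1)) = m * int (fib k)" by (simp only: of_int_eq_iff)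
  then have "int (fib k) dvd int (j * fib (k - 1))" by simp
  then have "fib k dvd j * fib (k - 1)" by (simp only: int_dvd_int_iff)
  moreover have "coprime (fib k) (fib (k - 1))"
    using coprime_fib_Suc_nat[of "k - 1"] assms(1) by (simp add: coprime_commute)
  ultimately have "fib k dvd j" by (simp add: coprime_dvd_mult_left_iff)
  then show False using assms by (simp add: nat_dvd_not_less)
qed

context curved_function
begin

lemma continuous: "continuous_on {0..1} g"
  using g by (meson DERIV_continuous_on)

lemma riemann_sum_error:
  fixes M n :: nat
  assumes "n \<le> M" "0 < M"
  shows "\<bar>(\<Sum>j<n. g (j / M)) - M * integral {0..n / M} g\<bar> \<le> n * B / M"
  using assms(1)
proof (induction n)
  case (Suc n)
  define a b where "a = n / M" and "b = Suc n / M"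
  have ab: "0 \<le> a" "a \<le> b" "b \<le> 1" "b - a = 1 / M"
    using Suc.prems assms(2) by (auto simp: a_def b_def divide_right_mono simp flip: diff_divide_distrib)
  have cont: "continuous_on {u..v} g" if "0 \<le> u" "v \<le> 1" for u v
    using that by (intro continuous_on_subset[OF continuous]) auto
  have "norm (integral {a..b} (\<lambda>x. g x - g a)) \<le> B / M * (b - a)"
  proof (rule integral_bound)
    fix x assume x: "x \<in> {a..b}"
    then have "\<bar>g x - g a\<bar> \<le> B * (x - a)" using ab by (intro lipschitz) auto
    also have "\<dots> \<le> B * (1 / M)" using x ab B_nonneg by (intro mult_left_mono) auto
    finally show "norm (g x - g a) \<le> B / M" by simp
  qed (use ab in \<open>auto intro!: continuous_intros cont\<close>)
  also have "integral {a..b} (\<lambda>x. g x - g a) = integral {a..b} g - (b - a) * g a"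
    using ab by (subst integral_diff) (auto intro!: integrable_continuous_real cont)
  finally have "M * \<bar>integral {a..b} g - (1 / M) * g a\<bar> \<le> M * (B / M * (1 / M))"
    using ab by (intro mult_left_mono) auto
  then have "\<bar>M * (integral {a..b} g - (1 / M) * g a)\<bar> \<le> B / M"
    using assms(2) by (simp add: abs_mult)
  then have 1: "\<bar>g a - M * integral {a..b} g\<bar> \<le> B / M"
    using assms(2) by (simp add: right_diff_distrib abs_minus_commute)
  have "integral {0..b} g = integral {0..a} g + integral {a..b} g"
    using ab by (intro Henstock_Kurzweil_Integration.integral_combine[symmetric] integrable_continuous_real cont) auto
  then have "(\<Sum>j<Suc n. g (j / M)) - M * integral {0..b} g
      = ((\<Sum>j<n. g (j / M)) - M * integral {0..a} g) + (g a - M * integral {a..b} g)"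
    by (simp add: algebra_simps a_def)
  also have "\<bar>\<dots>\<bar> \<le> n * B / M + B / M"
    using 1 Suc by (intro order_trans[OF abs_triangle_ineq] add_mono) (auto simp: a_def)
  also have "\<dots> = Suc n * B / M" by (simp add: add_divide_distrib distrib_right)
  finally show ?case by (simp add: b_def)
qed simp

lemma count_below_curve:
  fixes q t :: real and \<sigma> :: int
  assumes k: "1 \<le> k" and q: "q ^ 3 = real (fib k)" "2 \<le> q" "4 * B \<le> q" "2 * \<kappa> \<le> q"
    and \<sigma>: "\<sigma> = 1 \<or> \<sigma> = -1" and range: "\<And>x. x \<in> {0..1} \<Longrightarrow> 0 \<le> \<sigma> * g x \<and> \<sigma> * g x \<le> 1"
    and t: "t \<in> {0..1}"
  shows "\<bar>card {j\<in>{1..<fib k}. real j / fib k < t \<and> frac (j * (fib (k - 1) / fib k)) \<le> \<sigma> * g (j / fib k)}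
          - fib k * integral {0..t} (\<lambda>x. \<sigma> * g x)\<bar>
     \<le> ((80 + 12 * (6 + 9 / sqrt \<kappa>) * (4097 + 256 * B)) + (80 + 12 * 6 * (4097 + 256 * 0)) + (B + 2)) * q"
proof -
  define M where "M = fib k"
  define \<alpha> where "\<alpha> = real (fib (k - 1)) / fib k"
  define f where "f x = \<sigma> * g x" for x
  \<comment> \<open>The ceiling matches the strict inequality \<open>j / M < t\<close> of the
    half-open interval.\<close>
  define n where "n = nat \<lceil>t * M\<rceil>"
  have M: "0 < M" using k fib_neq_0_nat[of k] by (simp add: M_def)
  have tM: "0 \<le> t * M" "t * M \<le> M" using t by (auto simp: mult_left_le_one_le)
  then have n: "n \<le> M" unfolding n_def by linarith
  have j_less: "real j / M < t \<longleftrightarrow> j < n" for j :: nat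
  proof -
    have "real j / M < t \<longleftrightarrow> real j < t * M" using M by (simp add: divide_less_eq)
    also have "\<dots> \<longleftrightarrow> j < n" unfolding n_def using tM by linarith
    finally show ?thesis .
  qed
  define S where "S = {j\<in>{1..<M}. real j / M < t \<and> frac (j * \<alpha>) \<le> f (j / M)}"
  have f: "0 \<le> f (real j / M)" "f (real j / M) \<le> 1" if "j \<le> M" for j
    using that M range[of "real j / M"] by (auto simp: f_def)
  have "real (card S) = (\<Sum>j=1..<n. of_bool (frac (j * \<alpha>) \<le> f (j / M)))"
  proof -
    have "S = {1..<n} \<inter> {j. frac (j * \<alpha>) \<le> f (j / M)}" using n by (auto simp: S_def j_less)
    then show ?thesis by simp
  qed
  also have "\<dots> = (\<Sum>j=1..<n. f (j / M) - saw (j * \<alpha>) - saw (f (j / M) - j * \<alpha>))"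
  proof (intro sum.cong refl of_bool_frac_le_eq_saw)
    fix j assume j: "j \<in> {1..<n}"
    show "real j * \<alpha> \<notin> \<int>" unfolding \<alpha>_def using j n k by (intro fib_ratio_multiple_not_int) (auto simp: M_def)
    show "0 \<le> f (j / M)" "f (j / M) \<le> 1" using f[of j] j n by auto
  qed
  also have "\<dots> = (\<Sum>j=1..<n. f (j / M)) - (\<Sum>j=1..<n. saw (j * \<alpha>)) - (\<Sum>j=1..<n. saw (f (j / M) - j * \<alpha>))"
    by (simp add: sum_subtractf)
  finally have card_S: "real (card S) = \<dots>" .
  have lin: "\<bar>\<Sum>j=1..<n. saw (j * \<alpha>)\<bar> \<le> (80 + 12 * 6 * (4097 + 256 * 0)) * q"
    unfolding \<alpha>_def using n k q by (intro saw_sum_linear_le) (auto simp: M_def)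
  have "\<sigma> * (g (j / fib k) + real j * (- \<sigma> * (fib (k - 1) / fib k))) = f (j / M) - j * \<alpha>" for j
    using \<sigma> by (auto simp: f_def \<alpha>_def M_def)
  then have curve: "\<bar>\<Sum>j=1..<n. saw (f (j / M) - j * \<alpha>)\<bar> \<le> (80 + 12 * (6 + 9 / sqrt \<kappa>) * (4097 + 256 * B)) * q"
    using saw_sum_curve_le[of k n q \<sigma>] n k q \<sigma> by (simp add: M_def)
  \<comment> \<open>Of \<open>B + 2\<close>, the part \<open>B\<close> is the error of the left
    Riemann sum, one unit is the missing term \<open>j = 0\<close>, and one is the integral from
    \<open>t\<close> to \<open>n / M\<close>, scaled by \<open>M\<close>.\<close>
  have riemann: "\<bar>(\<Sum>j=1..<n. f (j / M)) - M * integral {0..t} f\<bar> \<le> B + 2"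
  proof -
    have cont: "continuous_on {u..v} f" if "0 \<le> u" "v \<le> 1" for u v
      using that unfolding f_def by (intro continuous_intros continuous_on_subset[OF continuous]) auto
    have tn: "t \<le> n / M" "n / M \<le> 1" "n / M - t \<le> 1 / M"
    proof -
      have "t * M \<le> n" "n - t * M \<le> 1" unfolding n_def using tM by linarith+
      then show "t \<le> n / M" "n / M \<le> 1" using M n by (auto simp: le_divide_eq)
      have "n / M - t = (n - t * M) / M" using M by (simp add: diff_divide_distrib)
      also have "\<dots> \<le> 1 / M" using \<open>n - t * M \<le> 1\<close> by (intro divide_right_mono) auto
      finally show "n / M - t \<le> 1 / M" .
    qed
    have "\<sigma> * (\<Sum>j<n. g (j / M)) - M * (\<sigma> * integral {0..n / M} g) = \<sigma> * ((\<Sum>j<n. g (j / M)) - M * integral {0..n / M} g)"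
      by (simp add: algebra_simps)
    also have "\<bar>\<dots>\<bar> \<le> n * B / M" using riemann_sum_error[OF n M] \<sigma> by auto
    also have "\<dots> \<le> B" using n M B_nonneg by (simp add: divide_le_eq mult.commute mult_left_mono)
    finally have 1: "\<bar>(\<Sum>j<n. f (j / M)) - M * integral {0..n / M} f\<bar> \<le> B"
      by (simp add: f_def[abs_def] sum_distrib_left)
    have 2: "\<bar>(\<Sum>j<n. f (j / M)) - (\<Sum>j=1..<n. f (j / M))\<bar> \<le> 1"
    proof (cases n)
      case (Suc m)
      have "{..<n} = insert 0 {1..<n}" using Suc by auto
      then show ?thesis using f[of 0] by simp
    qed simp
    have "integral {0..n / M} f = integral {0..t} f + integral {t..n / M} f"
      using t tn by (intro Henstock_Kurzweil_Integration.integral_combine[symmetric] integrable_continuous_real cont) auto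
    moreover have "norm (integral {t..n / M} f) \<le> 1 * (n / M - t)"
      using t tn range by (intro integral_bound cont) (auto simp: f_def)
    then have "M * \<bar>integral {t..n / M} f\<bar> \<le> M * (1 / M)"
      using tn by (intro mult_left_mono) auto
    then have "\<bar>M * integral {t..n / M} f\<bar> \<le> 1" using M by (simp add: abs_mult)
    ultimately have 3: "\<bar>M * integral {0..n / M} f - M * integral {0..t} f\<bar> \<le> 1" by (simp add: distrib_left)
    show ?thesis using 1 2 3 by linarith
  qed
  have "B + 2 \<le> (B + 2) * q" using B_nonneg q(2) by (simp add: mult_le_cancel_left1)
  then have "\<bar>real (card S) - M * integral {0..t} f\<bar>
     \<le> (80 + 12 * (6 + 9 / sqrt \<kappa>) * (4097 + 256 * B)) * q + (80 + 12 * 6 * (4097 + 256 * 0)) * q + (B + 2) * q"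
    using lin curve riemann unfolding card_S by linarith
  then show ?thesis by (simp add: S_def M_def \<alpha>_def f_def[abs_def] distrib_right)
qed

end

subsection \<open>The acceptance-rejection sampler\<close>

lemma length_filter_upt: "length (filter P [a..<b]) = card {j\<in>{a..<b}. P j}"
proof -
  have "{j\<in>{a..<b}. P j} = set (filter P [a..<b])" by auto
  then show ?thesis by (metis distinct_card distinct_filter distinct_upt)
qed

text \<open>The lattice point for \<open>j = M\<close> is \<open>(1, 0)\<close>. It is accepted,
  which explains \<open>Suc\<close>, but is never to the left of \<open>t \<le> 1\<close>; splitting
  it off leaves only indices for which the second coordinate is not 0.\<close>

lemma accept_reject_fib_lattice:
  assumes L: "0 < L" and k: "1 \<le> k" and \<psi>: "0 \<le> \<psi> 1"
  defines "M \<equiv> fib k" and "acc \<equiv> \<lambda>j. frac (real j * (fib (k - 1) / fib k)) \<le> \<psi> (j / fib k) / L"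
  shows "length (accept_reject \<psi> L (fib_lattice k)) = Suc (card {j\<in>{1..<M}. acc j})"
    and "t \<le> 1 \<Longrightarrow> length (filter (\<lambda>p. p < t) (accept_reject \<psi> L (fib_lattice k)))
           = card {j\<in>{1..<M}. real j / M < t \<and> acc j}"
proof -
  have M: "0 < M" using k fib_neq_0_nat[of k] by (simp add: M_def)
  have acc_iff: "L * frac (real j * real (fib (k - 1)) / real (fib k)) \<le> \<psi> (real j / real (fib k)) \<longleftrightarrow> acc j" for j
    using L by (simp add: acc_def le_divide_eq mult.commute)
  have acc_M: "acc M" using L \<psi> M by (simp add: acc_def M_def frac_def)
  have eq: "accept_reject \<psi> L (fib_lattice k) = map (\<lambda>j. real j / M) (filter acc [1..<M] @ [M])"
  proof -
    have "accept_reject \<psi> L (fib_lattice k) = map (\<lambda>j. real j / M) (filter acc [1..<M + 1])"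
      unfolding accept_reject_def fib_lattice_def M_def
      by (simp only: filter_map o_def map_map case_prod_conv fst_conv acc_iff)
    also have "[1..<M + 1] = [1..<M] @ [M]" using M by simp
    finally show ?thesis using acc_M by (simp only: filter_append filter.simps if_True)
  qed
  show "length (accept_reject \<psi> L (fib_lattice k)) = Suc (card {j\<in>{1..<M}. acc j})"
    unfolding eq by (simp add: length_filter_upt)
  assume t: "t \<le> 1"
  have "filter (\<lambda>p. p < t) (accept_reject \<psi> L (fib_lattice k)) = map (\<lambda>j. real j / M) (filter (\<lambda>j. real j / M < t \<and> acc j) [1..<M])"
    unfolding eq using M t by (simp add: filter_map o_def conj_commute)
  then show "length (filter (\<lambda>p. p < t) (accept_reject \<psi> L (fib_lattice k))) = card {j\<in>{1..<M}. real j / M < t \<and> acc j}"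
    by (simp add: length_filter_upt)
qed

text \<open>Turning \<open>q / N\<close> into a power of \<open>N\<close> requires
  \<open>M \<le> W * N\<close>. If the error is at most half of \<open>M * J\<close>, then
  \<open>N\<close> is at least \<open>M * J / 2\<close>; otherwise \<open>q^2\<close> is bounded,
  hence so is \<open>M\<close>, and \<open>1 \<le> N\<close> suffices. The two summands of
  \<open>W\<close> correspond to these cases.\<close>

lemma ratio_error_le:
  fixes M N A I J E q :: real
  assumes N: "1 \<le> N" and q: "M = q ^ 3" "1 \<le> q" and E: "0 \<le> E"
    and A: "\<bar>A - M * I\<bar> \<le> E * q" and NJ: "\<bar>N - M * J\<bar> \<le> (E + 1) * q"
    and I: "0 \<le> I" "I \<le> J" and J: "0 < J"
  shows "\<bar>A / N - I / J\<bar> \<le> (2 * E + 1) * (2 / J + (2 * (E + 1) / J)\<^sup>2) powr (1/3) * N powr (-2/3)"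
proof -
  define W where "W = 2 / J + (2 * (E + 1) / J)\<^sup>2"
  have W: "0 < W" unfolding W_def using J by (intro add_pos_nonneg) auto
  have "M \<le> W * N"
  proof (cases "(E + 1) * q \<le> M * J / 2")
    case True
    then have "M * J / 2 \<le> N" using NJ by linarith
    then have "M \<le> 2 / J * N" using J by (simp add: field_simps)
    also have "\<dots> \<le> W * N" using N by (intro mult_right_mono) (auto simp: W_def)
    finally show ?thesis .
  next
    case False
    then have "q\<^sup>2 * (q * (J / 2)) < (E + 1) * q" by (simp add: q(1) power2_eq_square power3_eq_cube mult_ac)
    then have "q * (q\<^sup>2 * (J / 2)) < q * (E + 1)" by (simp add: mult_ac)
    then have "q\<^sup>2 * (J / 2) < E + 1" using q(2) by (simp add: mult_less_cancel_left_pos)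
    then have "q\<^sup>2 \<le> 2 * (E + 1) / J" using J by (simp add: field_simps)
    then have "(q\<^sup>2)\<^sup>2 \<le> (2 * (E + 1) / J)\<^sup>2" by (intro power_mono) auto
    also have "\<dots> \<le> W" using J by (simp add: W_def)
    finally have "q ^ 4 \<le> W" by (simp flip: power_mult)
    have "q ^ 3 \<le> q ^ 4" using q(2) by (intro power_increasing) auto
    also have "\<dots> \<le> W * N" using \<open>q ^ 4 \<le> W\<close> W N by (smt (verit) mult_le_cancel_left1)
    finally show ?thesis using q(1) by simp
  qed
  have "q powr 3 = q ^ 3" using powr_realpow[of q 3] q(2) by simp
  then have "(q ^ 3) powr (1/3) = q powr (3 * (1/3))" by (metis powr_powr)
  then have "q = (q ^ 3) powr (1/3)" using q(2) by simp
  also have "\<dots> \<le> (W * N) powr (1/3)" using \<open>M \<le> W * N\<close> q by (intro powr_mono2) auto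
  also have "\<dots> = W powr (1/3) * N powr (1/3)" using W N by (simp add: powr_mult)
  finally have q_le: "q \<le> W powr (1/3) * N powr (1/3)" .
  have "A / N - I / J = ((A - M * I) * J - I * (N - M * J)) / (N * J)"
    using N J by (simp add: field_simps)
  also have "\<bar>\<dots>\<bar> = \<bar>(A - M * I) * J - I * (N - M * J)\<bar> / (N * J)" using N J by simp
  also have "\<dots> \<le> ((E * q) * J + J * ((E + 1) * q)) / (N * J)"
  proof (rule divide_right_mono)
    have "\<bar>(A - M * I) * J\<bar> \<le> (E * q) * J" unfolding abs_mult using A J by (intro mult_mono) auto
    moreover have "\<bar>I * (N - M * J)\<bar> \<le> J * ((E + 1) * q)" unfolding abs_mult using NJ I J by (intro mult_mono) auto
    ultimately show "\<bar>(A - M * I) * J - I * (N - M * J)\<bar> \<le> (E * q) * J + J * ((E + 1) * q)" by linarith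
  qed (use N J in auto)
  also have "\<dots> = (2 * E + 1) * (q / N)" using N J by (simp add: field_simps)
  also have "\<dots> \<le> (2 * E + 1) * (W powr (1/3) * N powr (1/3) / N)"
    using q_le N E by (intro mult_left_mono divide_right_mono) auto
  also have "W powr (1/3) * N powr (1/3) / N = W powr (1/3) * N powr (-2/3)"
    using N powr_diff[of N "1/3" 1] by simp
  finally show ?thesis by (simp add: W_def mult.assoc)
qed

text \<open>A continuous second derivative without zeros has constant sign on the connected
  interval, which gives \<open>\<sigma>\<close>; compactness then provides the minimum
  \<open>\<kappa>\<close> of \<open>g''\<close> and the maximum \<open>B\<close> of the modulus of
  \<open>g'\<close>.\<close>

lemma curvature_data:
  assumes C2: "C2_nonvanishing_curv \<psi>" and L: "0 < L"
  obtains \<sigma> :: int and g' g'' B \<kappa> where "\<sigma> = 1 \<or> \<sigma> = -1"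
    "curved_function (\<lambda>x. \<sigma> * (\<psi> x / L)) g' g'' B \<kappa>"
proof -
  obtain \<psi>' \<psi>'' where d: "\<And>x. x \<in> {0..1} \<Longrightarrow> (\<psi> has_real_derivative \<psi>' x) (at x within {0..1})"
      "\<And>x. x \<in> {0..1} \<Longrightarrow> (\<psi>' has_real_derivative \<psi>'' x) (at x within {0..1})"
    and cont: "continuous_on {0..1} \<psi>''" and nz: "\<And>x. x \<in> {0..1} \<Longrightarrow> \<psi>'' x \<noteq> 0"
    using C2 unfolding C2_nonvanishing_curv_def by metis
  have "(\<forall>x\<in>{0..1}. 0 < \<psi>'' x) \<or> (\<forall>x\<in>{0..1}. \<psi>'' x < 0)"
  proof (rule ccontr)
    assume "\<not> ?thesis"
    then obtain x y where xy: "x \<in> {0..1}" "y \<in> {0..1}" "\<psi>'' x \<le> 0" "0 \<le> \<psi>'' y" by force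
    have "connected (\<psi>'' ` {0..1})" using cont by (intro connected_continuous_image) auto
    then have "0 \<in> \<psi>'' ` {0..1}" using xy by (meson connectedD_interval imageI)
    then show False using nz by force
  qed
  then have "\<exists>\<sigma>::int. (\<sigma> = (1::int) \<or> \<sigma> = (-1::int)) \<and> (\<forall>x\<in>{0..1}. 0 < \<sigma> * \<psi>'' x)"
  proof
    assume "\<forall>x\<in>{0..1}. 0 < \<psi>'' x"
    then show ?thesis by (intro exI[of _ 1]) simp
  next
    assume "\<forall>x\<in>{0..1}. \<psi>'' x < 0"
    then show ?thesis by (intro exI[of _ "-1"]) simp
  qed
  then obtain \<sigma> :: int where \<sigma>: "\<sigma> = 1 \<or> \<sigma> = -1" and pos': "\<forall>x\<in>{0..1}. 0 < \<sigma> * \<psi>'' x"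
    by (elim exE conjE)
  note pos = bspec[OF pos']
  define g' where "g' x = \<sigma> * (\<psi>' x / L)" for x
  define g'' where "g'' x = \<sigma> * (\<psi>'' x / L)" for x
  have "continuous_on {0..1} g''" unfolding g''_def using L by (intro continuous_intros cont) auto
  then obtain x0 where x0: "x0 \<in> {0..1}" "\<And>x. x \<in> {0..1} \<Longrightarrow> g'' x0 \<le> g'' x"
    using continuous_attains_inf[of "{0..1::real}" g''] by auto
  have "continuous_on {0..1} \<psi>'" using d(2) by (meson DERIV_continuous_on)
  then have "continuous_on {0..1} (\<lambda>x. \<bar>g' x\<bar>)" unfolding g'_def using L by (intro continuous_intros) auto
  then have "\<exists>x1\<in>{0..1}. \<forall>x\<in>{0..1}. \<bar>g' x\<bar> \<le> \<bar>g' x1\<bar>"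
    by (intro continuous_attains_sup) auto
  then obtain x1 where x1: "\<And>x. x \<in> {0..1} \<Longrightarrow> \<bar>g' x\<bar> \<le> \<bar>g' x1\<bar>"
    by blast
  have "curved_function (\<lambda>x. \<sigma> * (\<psi> x / L)) g' g'' \<bar>g' x1\<bar> (g'' x0)"
  proof
    show "((\<lambda>x. \<sigma> * (\<psi> x / L)) has_real_derivative g' x) (at x within {0..1})" if "x \<in> {0..1}" for x
      unfolding g'_def using L by (auto intro!: derivative_eq_intros d(1)[OF that])
    show "(g' has_real_derivative g'' x) (at x within {0..1})" if "x \<in> {0..1}" for x
      unfolding g'_def g''_def using L by (auto intro!: derivative_eq_intros d(2)[OF that])
    show "0 < g'' x0" using pos[OF x0(1)] L by (simp add: g''_def)
  qed (use x0 x1 in auto)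
  then show ?thesis using \<sigma> that by blast
qed

theorem theorem2:
  fixes \<psi> :: "real \<Rightarrow> real" and L :: real
  assumes "C2_nonvanishing_curv \<psi>"
    and "\<forall>x\<in>{0..1}. 0 \<le> \<psi> x"
    and "\<forall>x\<in>{0..1}. \<psi> x \<le> L"
  shows "\<exists>C'::real. \<forall>k\<ge>3.
           length (accept_reject \<psi> L (fib_lattice k)) \<ge> 1 \<longrightarrow>
           disc_star \<psi> (accept_reject \<psi> L (fib_lattice k))
             \<le> C' * real (length (accept_reject \<psi> L (fib_lattice k))) powr (-2/3)"
proof -
  \<comment> \<open>Zeros at \<open>0\<close>, \<open>1/2\<close> and \<open>1\<close> contradict
    the strictly positive second difference. The divisor is 1 here because the positivity of
    \<open>L\<close> is deduced from this step.\<close>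
  have "\<exists>z\<in>{0..1}. \<psi> z \<noteq> 0"
  proof (rule ccontr)
    assume "\<not> ?thesis"
    then have zero: "\<psi> 0 = 0" "\<psi> (1/2) = 0" "\<psi> 1 = 0" by auto
    obtain \<sigma> g' g'' B \<kappa> where "\<sigma> = 1 \<or> \<sigma> = (-1::int)"
      and "curved_function (\<lambda>x. of_int \<sigma> * (\<psi> x / 1)) g' g'' B \<kappa>"
      by (rule curvature_data[OF assms(1) zero_less_one])
    then interpret curved: curved_function "\<lambda>x. of_int \<sigma> * (\<psi> x / 1)" g' g'' B \<kappa> by simp
    show False using curved.second_difference_ge[of 0 "1/2"] curved.\<kappa>(1) by (simp add: zero power2_eq_square)
  qed
  then obtain z where z: "z \<in> {0..1}" "0 < \<psi> z" using assms(2) by force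
  then have L: "0 < L" using assms(3) by force
  obtain \<sigma> g' g'' B \<kappa> where \<sigma>: "\<sigma> = 1 \<or> \<sigma> = (-1::int)"
    and curved: "curved_function (\<lambda>x. \<sigma> * (\<psi> x / L)) g' g'' B \<kappa>"
    by (rule curvature_data[OF assms(1) L])
  interpret curved_function "\<lambda>x. \<sigma> * (\<psi> x / L)" g' g'' B \<kappa> by (rule curved)
  define f where "f x = \<psi> x / L" for x
  have \<sigma>f: "\<sigma> * (\<sigma> * (\<psi> x / L)) = f x" for x using \<sigma> by (auto simp: f_def)
  have f_range: "0 \<le> f x" "f x \<le> 1" if "x \<in> {0..1}" for x using assms(2,3) that L by (auto simp: f_def)
  have "continuous_on {0..1} (\<lambda>x. \<sigma> * (\<sigma> * (\<psi> x / L)))"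
    by (intro continuous_intros continuous)
  then have f_cont: "continuous_on {u..v} f" if "0 \<le> u" "v \<le> 1" for u v
    unfolding \<sigma>f by (rule continuous_on_subset) (use that in auto)
  define I where "I t = integral {0..t} f" for t
  have I_eq: "integral {0..t} \<psi> = L * I t" for t using L by (simp add: I_def f_def[abs_def])
  have I_bounds: "0 \<le> I t" "I t \<le> I 1" if "t \<in> {0..1}" for t
  proof -
    show "0 \<le> I t" unfolding I_def using that f_range by (intro integral_nonneg integrable_continuous_real f_cont) auto
    show "I t \<le> I 1" unfolding I_def using that f_range by (intro integral_subset_le integrable_continuous_real f_cont) auto
  qed
  have I1: "0 < I 1"
  proof -
    have "I 1 \<noteq> 0"
    proof
      assume "I 1 = 0"
      then have "(f has_integral 0) (cbox 0 1)"
        using integrable_integral[OF integrable_continuous_real[OF f_cont[of 0 1]]] by (simp add: I_def)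
      then have "f z = 0"
        using z f_range f_cont[of 0 1] by (intro has_integral_0_cbox_imp_0[of 0 1 f]) auto
      then show False using z L by (simp add: f_def)
    qed
    then show ?thesis using I_bounds(1)[of 1] by simp
  qed
  have I_le1: "I t \<le> 1" if "t \<in> {0..1}" for t
  proof -
    have "norm (I t) \<le> 1 * (t - 0)" unfolding I_def using that f_range by (intro integral_bound f_cont) auto
    moreover have "t \<le> 1" using that by simp
    ultimately show ?thesis by (simp add: abs_le_iff)
  qed
  define q0 where "q0 = max 2 (max (4 * B) (2 * \<kappa>))"
  define E0 where "E0 = (80 + 12 * (6 + 9 / sqrt \<kappa>) * (4097 + 256 * B)) + (80 + 12 * 6 * (4097 + 256 * 0)) + (B + 2)"
  \<comment> \<open>Below the threshold \<open>q0\<close> the count is compared trivially with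
    \<open>M < q0^3\<close>, so this term absorbs all small \<open>k\<close>.\<close>
  define E where "E = max E0 (q0 ^ 3)"
  have "2 ^ 3 \<le> q0 ^ 3" by (intro power_mono) (auto simp: q0_def)
  then have E: "0 \<le> E" unfolding E_def by simp
  have count: "\<bar>card {j\<in>{1..<fib k}. real j / fib k < t \<and> frac (j * (fib (k - 1) / fib k)) \<le> f (j / fib k)} - fib k * I t\<bar> \<le> E * q"
    if k: "1 \<le> k" and q: "q ^ 3 = real (fib k)" "1 \<le> q" and t: "t \<in> {0..1}" for k q t
  proof (cases "q0 \<le> q")
    case True
    then have "\<bar>card {j\<in>{1..<fib k}. real j / fib k < t \<and> frac (j * (fib (k - 1) / fib k)) \<le> f (j / fib k)} - fib k * I t\<bar> \<le> E0 * q"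
      using count_below_curve[OF k q(1) _ _ _ \<sigma> _ t] f_range
      unfolding \<sigma>f I_def E0_def q0_def by simp
    also have "\<dots> \<le> E * q" using q by (intro mult_right_mono) (auto simp: E_def)
    finally show ?thesis .
  next
    case False
    define c where "c = card {j\<in>{1..<fib k}. real j / fib k < t \<and> frac (j * (fib (k - 1) / fib k)) \<le> f (j / fib k)}"
    have "c \<le> card {1..<fib k}" unfolding c_def by (intro card_mono) auto
    then have "real c \<le> real (fib k)" by simp
    moreover have "real (fib k) * I t \<le> real (fib k) * 1" using I_le1[OF t] by (intro mult_left_mono) auto
    moreover have "0 \<le> fib k * I t" using I_bounds(1)[OF t] by simp
    ultimately have "\<bar>c - fib k * I t\<bar> \<le> real (fib k)" by simp
    also have "\<dots> \<le> q0 ^ 3" unfolding q(1)[symmetric] using False q by (intro power_mono) auto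
    also have "\<dots> \<le> E * 1" by (simp add: E_def)
    also have "\<dots> \<le> E * q" using E q by (intro mult_left_mono) auto
    finally show ?thesis by (simp add: c_def)
  qed
  define C where "C = (2 * E + 1) * (2 / I 1 + (2 * (E + 1) / I 1)\<^sup>2) powr (1/3)"
  show ?thesis
  proof (intro exI[of _ C] allI impI)
    fix k :: nat assume "3 \<le> k"
    then have k: "1 \<le> k" by simp
    define P where "P = accept_reject \<psi> L (fib_lattice k)"
    define q where "q = root 3 (real (fib k))"
    have fib_pos: "0 < fib k" using k fib_neq_0_nat[of k] by simp
    have q: "q ^ 3 = real (fib k)" "1 \<le> q" using fib_pos by (auto simp: q_def)
    have \<psi>1: "0 \<le> \<psi> 1" using assms(2) by simp
    note len = accept_reject_fib_lattice[where \<psi> = \<psi>, OF L k \<psi>1, folded P_def f_def]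
    have N: "1 \<le> real (length P)" using len(1) by simp
    have A: "\<bar>real (length (filter (\<lambda>p. p < t) P)) - fib k * I t\<bar> \<le> E * q" if "t \<in> {0..1}" for t
      using count[OF k q that] len(2)[of t] that by simp
    have "{j\<in>{1..<fib k}. frac (real j * (fib (k - 1) / fib k)) \<le> f (j / fib k)}
       = {j\<in>{1..<fib k}. real j / fib k < 1 \<and> frac (j * (fib (k - 1) / fib k)) \<le> f (j / fib k)}"
      using fib_pos by auto
    \<comment> \<open>The total exceeds the count at \<open>t = 1\<close> by the accepted point with
      abscissa 1; this turns \<open>E\<close> into \<open>E + 1\<close>, using
      \<open>1 \<le> q\<close>.\<close>
    then have "real (length P) = real (length (filter (\<lambda>p. p < 1) P)) + 1"
      using len(1) len(2)[of 1] by simp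
    then have NJ: "\<bar>real (length P) - fib k * I 1\<bar> \<le> (E + 1) * q"
      using A[of 1] q(2) by (simp add: distrib_right)
    show "disc_star \<psi> P \<le> C * real (length P) powr (-2/3)"
      unfolding disc_star_def
    proof (rule cSUP_least)
      fix t :: real assume t: "t \<in> {0..1}"
      have "integral {0..t} \<psi> / integral {0..1} \<psi> = I t / I 1" using L by (simp add: I_eq)
      then show "\<bar>real (length (filter (\<lambda>p. p < t) P)) / real (length P) - integral {0..t} \<psi> / integral {0..1} \<psi>\<bar>
         \<le> C * real (length P) powr (-2/3)"
        using ratio_error_le[OF N q(1)[symmetric] q(2) E A[OF t] NJ I_bounds[OF t] I1] by (simp add: C_def)
    qed auto
  qed
qed

end
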